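(* Let $\mathbb F$ be an algebraically closed field of characteristic zero, $\mathfrak g=\mathfrak{gl}(\mathbb V)$ with $\dim\mathbb V=n<\infty$ (so $\mathrm{rk}\,\mathfrak g=n$), and $e\in\mathfrak g$ a nilpotent element with $k$ Jordan blocks. Let $1\le\ell\le\mathrm{rk}\,\mathfrak g$ and set $m:=\deg{}^{e}\!F_\ell$. Then, up to a non-zero constant, $${}^{e}\!F_\ell=\sum_{|I|=m,\ \lambda(I,\sigma,\bar s)=2(\ell-m)}(\mathrm{sgn}\,\sigma)\,\Xi(I,\sigma,\bar s),$$ where the summation is taken over all subsets $I\subset\{1,\ldots,k\}$ with $|I|=m$, all permutations $\sigma$ of $I$, and all functions $\bar s\colon I\to\mathbb Z_{\ge0}$ satisfying $\lambda(I,\sigma,\bar s)=2(\ell-m)$.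
   Context: Let $d_1+1\ge\cdots\ge d_k+1$ be the sizes of the Jordan blocks of $e$, and choose vectors $w_1,\ldots,w_k\in\mathbb V$ such that the $e^sw_i$ ($1\le i\le k$, $0\le s\le d_i$) form a basis of $\mathbb V$ and $e^{d_i+1}w_i=0$. The centraliser $\mathfrak g_e$ has the basis $\xi_i^{j,s}$ ($1\le i,j\le k$, $\max\{d_j-d_i,0\}\le s\le d_j$), where $\xi_i^{j,s}$ is the endomorphism commuting with $e$ with $\xi_i^{j,s}(w_i)=e^sw_j$ and $\xi_i^{j,s}(w_t)=0$ for $t\ne i$. Put $\xi_i^{j,s}:=0$ if $s$ is outside this range. Let $(e,h,f)$ be the $\mathfrak{sl}_2$-triple in $\mathfrak g$ with $h(e^sw_i)=(2s-d_i)e^sw_i$; then each $\xi_i^{j,s}$ is an eigenvector of $\mathrm{ad}\,h$. Definition of ${}^{e}\!F$: identify $\mathfrak g$ with $\mathfrak g^*$ via the trace form $(x,y)\mapsto\mathrm{tr}(xy)$, so that elements $F\in\mathcal S(\mathfrak g)$ (the symmetric algebra) are polynomial functions on $\mathfrak g$. The slice $e+\mathfrak g_f$ is identified with $\mathfrak g_e^*$ by sending $e+y$, $y\in\mathfrak g_f$, to the linear function $x\mapsto\mathrm{tr}(xy)$ on $\mathfrak g_e$. For homogeneous $F\in\mathcal S(\mathfrak g)$, restrict $F$ to $e+\mathfrak g_f$, regard the restriction as a polynomial in $y\in\mathfrak g_f\cong\mathfrak g_e^*$, i.e. as an element of $\mathcal S(\mathfrak g_e)=\mathbb F[\mathfrak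 g_e^*]$, and let ${}^{e}\!F\in\mathcal S(\mathfrak g_e)$ be its (nonzero) homogeneous component of minimal degree. The $F_\ell\in\mathcal S(\mathfrak g)^{\mathfrak g}$, $1\le\ell\le n$, correspond to the coefficients $\Delta_\ell$ of the characteristic polynomial: $\Delta_\ell(\xi)$ is (up to sign) the coefficient of $t^{n-\ell}$ in $\det(t\cdot\mathrm{id}-\xi)$, so $\deg F_\ell=\ell$. For $I=\{i_1,\ldots,i_m\}\subset\{1,\ldots,k\}$, a permutation $\sigma$ of $I$ and $\bar s\colon I\to\mathbb Z_{\ge0}$, put $$\Xi(I,\sigma,\bar s)=\xi_{i_1}^{\sigma(i_1),\bar s(i_1)}\xi_{i_2}^{\sigma(i_2),\bar s(i_2)}\cdots\xi_{i_m}^{\sigma(i_m),\bar s(i_m)}\in\mathcal S(\mathfrak g_e),$$ and let $\lambda(I,\sigma,\bar s)$ be the weight of this monomial with respect to $h$, i.e. the sum of the $\mathrm{ad}\,h$-eigenvalues of its factors (triples with $\Xi(I,\sigma,\bar s)=0$ contribute nothing). *)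

theory Defs
  imports
    "Jordan_Normal_Form.Jordan_Normal_Form"
    "Jordan_Normal_Form.VS_Connect"
    "HOL-Library.FuncSet"
begin

text \<open>
  The space \<open>\<bbbV>\<close> is \<^term>\<open>carrier_vec n\<close> and \<open>\<gg>\<ll>(\<bbbV>)\<close> is \<^term>\<open>carrier_mat n n\<close>.
\<close>

definition mat_trace :: "'a::comm_monoid_add mat \<Rightarrow> 'a" where
  "mat_trace A = (\<Sum>i<dim_row A. A $$ (i, i))"

definition commutator :: "'a::ring mat \<Rightarrow> 'a mat \<Rightarrow> 'a mat" where
  "commutator A B = A * B - B * A"

definition centraliser :: "nat \<Rightarrow> 'a::semiring_0 mat \<Rightarrow> 'a mat set" where
  "centraliser n x = {y \<in> carrier_mat n n. x * y = y * x}"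

definition sl2_triple :: "nat \<Rightarrow> 'a::comm_ring_1 mat \<Rightarrow> 'a mat \<Rightarrow> 'a mat \<Rightarrow> bool" where
  "sl2_triple n e h f \<longleftrightarrow>
     e \<in> carrier_mat n n \<and> h \<in> carrier_mat n n \<and> f \<in> carrier_mat n n \<and>
     commutator h e = 2 \<cdot>\<^sub>m e \<and> commutator h f = (- 2) \<cdot>\<^sub>m f \<and> commutator e f = h"

text \<open>
  The algebra \<open>S(\<gg>\<^sub>e) = \<bbbF>[\<gg>\<^sub>e\<^sup>*]\<close> is realised, over an infinite field, as an algebra of polynomial
  functions on \<open>\<gg>\<^sub>e\<^sup>*\<close>, where \<open>\<gg>\<^sub>e\<^sup>*\<close> is identified with \<open>\<gg>\<^sub>f\<close> by the trace form.  The element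
  \<open>x \<in> \<gg>\<^sub>e\<close> is the function sending \<open>y \<in> \<gg>\<^sub>f\<close> to \<open>tr(xy)\<close>.  All functions are \<open>undefined\<close>
  outside \<open>\<gg>\<^sub>f\<close>, so that equality of such functions is equality in \<open>S(\<gg>\<^sub>e)\<close>.
\<close>

definition sym_zero :: "nat \<Rightarrow> 'a::field mat \<Rightarrow> 'a mat \<Rightarrow> 'a" where
  "sym_zero n f = (\<lambda>y\<in>centraliser n f. 0)"

text \<open>\<open>S\<^sup>d(\<gg>\<^sub>e)\<close>: linear combinations of products of \<open>d\<close> elements of \<open>\<gg>\<^sub>e\<close>.\<close>

definition sym_hom ::
    "nat \<Rightarrow> 'a::field mat \<Rightarrow> 'a mat \<Rightarrow> nat \<Rightarrow> ('a mat \<Rightarrow> 'a) set" where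
  "sym_hom n e f d =
     {p. \<exists>(N::nat) (c :: nat \<Rightarrow> 'a) (X :: nat \<Rightarrow> nat \<Rightarrow> 'a mat).
           (\<forall>r<N. \<forall>i<d. X r i \<in> centraliser n e) \<and>
           p = (\<lambda>y\<in>centraliser n f. \<Sum>r<N. c r * (\<Prod>i<d. mat_trace (X r i * y)))}"

definition hom_decomposition ::
    "nat \<Rightarrow> 'a::field mat \<Rightarrow> 'a mat \<Rightarrow> ('a mat \<Rightarrow> 'a) \<Rightarrow> (nat \<Rightarrow> 'a mat \<Rightarrow> 'a) \<Rightarrow> bool" where
  "hom_decomposition n e f p c \<longleftrightarrow>
     (\<forall>d. c d \<in> sym_hom n e f d) \<and>
     finite {d. c d \<noteq> sym_zero n f} \<and>
     p = (\<lambda>y\<in>centraliser n f. \<Sum>d | c d \<noteq> sym_zero n f. c d y)"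

definition hom_component ::
    "nat \<Rightarrow> 'a::field mat \<Rightarrow> 'a mat \<Rightarrow> ('a mat \<Rightarrow> 'a) \<Rightarrow> nat \<Rightarrow> 'a mat \<Rightarrow> 'a" where
  "hom_component n e f p = (THE c. hom_decomposition n e f p c)"

definition slice_restriction ::
    "nat \<Rightarrow> 'a::field mat \<Rightarrow> 'a mat \<Rightarrow> ('a mat \<Rightarrow> 'a) \<Rightarrow> 'a mat \<Rightarrow> 'a" where
  "slice_restriction n e f F = (\<lambda>y\<in>centraliser n f. F (e + y))"

text \<open>\<open>initial_degree n e f F\<close> is the degree of \<open>\<^sup>eF\<close>, and \<open>initial_form n e f F\<close> is \<open>\<^sup>eF\<close>.\<close>

definition initial_degree ::
    "nat \<Rightarrow> 'a::field mat \<Rightarrow> 'a mat \<Rightarrow> ('a mat \<Rightarrow> 'a) \<Rightarrow> nat" where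
  "initial_degree n e f F =
     (LEAST d. hom_component n e f (slice_restriction n e f F) d \<noteq> sym_zero n f)"

definition initial_form ::
    "nat \<Rightarrow> 'a::field mat \<Rightarrow> 'a mat \<Rightarrow> ('a mat \<Rightarrow> 'a) \<Rightarrow> 'a mat \<Rightarrow> 'a" where
  "initial_form n e f F =
     hom_component n e f (slice_restriction n e f F) (initial_degree n e f F)"

definition char_coeff :: "nat \<Rightarrow> nat \<Rightarrow> 'a::field mat \<Rightarrow> 'a" where
  "char_coeff n l x = coeff (char_poly x) (n - l)"

text \<open>
  The tuple \<open>(d, w)\<close> with indices in \<open>{1..k}\<close> is a choice of Jordan block sizes \<open>d i + 1\<close> and
  of generators \<open>w i\<close> of the Jordan blocks of \<open>e\<close>.
\<close>

definition jordan_generators ::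
    "nat \<Rightarrow> 'a::field mat \<Rightarrow> nat \<Rightarrow> (nat \<Rightarrow> nat) \<Rightarrow> (nat \<Rightarrow> 'a vec) \<Rightarrow> bool" where
  "jordan_generators n e k d w \<longleftrightarrow>
     jordan_nf e (map (\<lambda>i. (d i + 1, 0)) [1..<k + 1]) \<and>
     (\<forall>i\<in>{1..k}. \<forall>j\<in>{1..k}. i \<le> j \<longrightarrow> d j + 1 \<le> d i + 1) \<and>
     (\<forall>i\<in>{1..k}. w i \<in> carrier_vec n) \<and>
     inj_on (\<lambda>(i, s). (e ^\<^sub>m s) *\<^sub>v w i) (SIGMA i:{1..k}. {0..d i}) \<and>
     vectorspace.basis class_ring (module_vec TYPE('a) n)
       ((\<lambda>(i, s). (e ^\<^sub>m s) *\<^sub>v w i) ` (SIGMA i:{1..k}. {0..d i})) \<and>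
     (\<forall>i\<in>{1..k}. (e ^\<^sub>m (d i + 1)) *\<^sub>v w i = 0\<^sub>v n)"

text \<open>
  The range of \<open>s\<close> for which \<open>\<xi>\<^sub>i\<^sup>j\<^sup>,\<^sup>s\<close> is a basis vector of \<open>\<gg>\<^sub>e\<close>; on \<^typ>\<open>nat\<close> the difference
  \<open>d j - d i\<close> already equals \<open>max (d\<^sub>j - d\<^sub>i) 0\<close>.
\<close>

definition xi_range :: "(nat \<Rightarrow> nat) \<Rightarrow> nat \<Rightarrow> nat \<Rightarrow> nat set" where
  "xi_range d i j = {d j - d i..d j}"

definition xi ::
    "nat \<Rightarrow> 'a::field mat \<Rightarrow> nat \<Rightarrow> (nat \<Rightarrow> nat) \<Rightarrow> (nat \<Rightarrow> 'a vec) \<Rightarrow> nat \<Rightarrow> nat \<Rightarrow> nat \<Rightarrow> 'a mat" where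
  "xi n e k d w i j s =
     (if s \<in> xi_range d i j
      then (THE x. x \<in> centraliser n e \<and>
              (\<forall>t\<in>{1..k}. x *\<^sub>v w t = (if t = i then (e ^\<^sub>m s) *\<^sub>v w j else 0\<^sub>v n)))
      else 0\<^sub>m n n)"

definition ad_eigenvalue :: "'a::field mat \<Rightarrow> 'a mat \<Rightarrow> 'a" where
  "ad_eigenvalue h x = (THE a. commutator h x = a \<cdot>\<^sub>m x)"

definition Xi ::
    "nat \<Rightarrow> 'a::field mat \<Rightarrow> 'a mat \<Rightarrow> nat \<Rightarrow> (nat \<Rightarrow> nat) \<Rightarrow> (nat \<Rightarrow> 'a vec)
      \<Rightarrow> nat set \<Rightarrow> (nat \<Rightarrow> nat) \<Rightarrow> (nat \<Rightarrow> nat) \<Rightarrow> 'a mat \<Rightarrow> 'a" where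
  "Xi n e f k d w I \<sigma> s =
     (\<lambda>y\<in>centraliser n f. \<Prod>i\<in>I. mat_trace (xi n e k d w i (\<sigma> i) (s i) * y))"

definition Xi_weight ::
    "nat \<Rightarrow> 'a::field mat \<Rightarrow> 'a mat \<Rightarrow> nat \<Rightarrow> (nat \<Rightarrow> nat) \<Rightarrow> (nat \<Rightarrow> 'a vec)
      \<Rightarrow> nat set \<Rightarrow> (nat \<Rightarrow> nat) \<Rightarrow> (nat \<Rightarrow> nat) \<Rightarrow> 'a" where
  "Xi_weight n e h k d w I \<sigma> s = (\<Sum>i\<in>I. ad_eigenvalue h (xi n e k d w i (\<sigma> i) (s i)))"

text \<open>
  Only triples all of whose factors \<open>\<xi>\<close> are basis vectors are listed: the other ones have
  \<open>\<Xi>(I,\<sigma>,s) = 0\<close>, and a zero factor has no \<open>ad h\<close>-eigenvalue.  Functions \<open>s\<close> on \<open>I\<close> are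
  extensional and \<open>\<sigma>\<close> is the identity outside \<open>I\<close>, so no triple is listed twice.
\<close>

definition Xi_indices ::
    "nat \<Rightarrow> 'a::field mat \<Rightarrow> 'a mat \<Rightarrow> nat \<Rightarrow> (nat \<Rightarrow> nat) \<Rightarrow> (nat \<Rightarrow> 'a vec) \<Rightarrow> nat \<Rightarrow> 'a
      \<Rightarrow> (nat set \<times> (nat \<Rightarrow> nat) \<times> (nat \<Rightarrow> nat)) set" where
  "Xi_indices n e h k d w m a =
     {(I, \<sigma>, s). I \<subseteq> {1..k} \<and> card I = m \<and> \<sigma> permutes I \<and>
        s \<in> (\<Pi>\<^sub>E i\<in>I. xi_range d i (\<sigma> i)) \<and> Xi_weight n e h k d w I \<sigma> s = a}"

end

theory Submission
  imports Defs "Jordan_Normal_Form.DL_Rank"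
begin

text \<open>
  In the basis \<open>e\<^sup>s w\<^sub>i\<close>, the value \<open>F\<^sub>l(e + y)\<close> is the coefficient of \<open>u\<^sup>l\<close> in \<open>det (1 - u e - u y)\<close>.
  Expanding by rows, its part of degree \<open>m\<close> in \<open>y\<close> is a sum over sets \<open>T\<close> of \<open>m\<close> rows taken from \<open>- u y\<close>, the
  other rows coming from \<open>1 - u e\<close>; multiplying by \<open>(1 - u e)\<^sup>-\<^sup>1 = \<Sum> u\<^sup>s e\<^sup>s\<close>, which has determinant \<open>1\<close>, turns
  each of them into a principal \<open>T\<close>-minor of \<open>- u y (1 - u e)\<^sup>-\<^sup>1\<close>.  If \<open>l\<close> exceeds the total size of the \<open>m - 1\<close>
  largest Jordan blocks, then for degree reasons only the sets \<open>T\<close> meeting \<open>m\<close> different blocks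
  contribute, and their minors add up to the alternating sum over \<open>(I, \<sigma>, s)\<close>.
  A block diagonal \<open>y\<close> shows that the least \<open>m\<close> for which \<open>l\<close> does not exceed the total size of
  the \<open>m\<close> largest blocks has a nonzero component, so the initial degree satisfies that
  hypothesis.
\<close>

section \<open>Determinants over finite index sets\<close>

text \<open>The reversed polynomial \<open>det (1 - u x)\<close> is used because
  \<open>1 - u e\<close> is invertible over the polynomial ring. Powers of \<open>u\<close> then
  count climbing: a term with rows \<open>(i, a i)\<close> and columns \<open>(j, b j)\<close> in
  \<open>m\<close> different blocks has exponent \<open>m\<close> plus the sum of all
  \<open>b j - a j\<close>. Regrouped along a permutation, the jumps
  \<open>s i = b (\<sigma> i) - a i\<close> add up to \<open>l - m\<close>. In the weight, the sum
  of \<open>2 s i - d (\<sigma> i) + d i\<close>, the block sizes cancel, which is the origin of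
  \<open>2 (l - m)\<close>. For fixed jumps, summing over the starting heights \<open>a i\<close>
  yields the traces \<open>tr (\<xi> y)\<close>. Since \<open>f\<close> is given only through the
  relations of the triple, its matrix has to be recovered first. Commuting with \<open>f\<close>
  then makes the entries of \<open>y\<close> along a diagonal positive rational multiples of the
  first one. Positivity keeps the sums of these multiples nonzero. This serves twice: every entry of
  \<open>y\<close> becomes a linear function coming from the centraliser of \<open>e\<close>, so
  that the parts of degree \<open>m\<close> are honest homogeneous components, and the component at
  the witness does not vanish.\<close>

definition sdet :: "'b set \<Rightarrow> ('b \<Rightarrow> 'b \<Rightarrow> 'a::comm_ring_1) \<Rightarrow> 'a" where
  "sdet B M = (\<Sum>p | p permutes B. of_int (sign p) * (\<Prod>b\<in>B. M b (p b)))"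

lemma sdet_cong:
  assumes "\<And>b c. b \<in> B \<Longrightarrow> c \<in> B \<Longrightarrow> M b c = N b c"
  shows "sdet B M = sdet B N"
  unfolding sdet_def
  by (intro sum.cong refl arg_cong2[of _ _ _ _ "(*)"] prod.cong assms) (auto simp: permutes_in_image)

lemma bij_betw_map_permutation:
  assumes "bij_betw \<beta> A B"
  shows "bij_betw (map_permutation A \<beta>) {p. p permutes A} {p. p permutes B}"
proof -
  have inv: "bij_betw (inv_into A \<beta>) B A" by (rule bij_betw_inv_into[OF assms])
  show ?thesis
  proof (rule bij_betw_byWitness[where f' = "map_permutation B (inv_into A \<beta>)"])
    show "\<forall>p\<in>{p. p permutes A}. map_permutation B (inv_into A \<beta>) (map_permutation A \<beta> p) = p"
      using assms by (auto intro!: map_permutation_compose_inv simp: bij_betw_def)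
    show "\<forall>p\<in>{p. p permutes B}. map_permutation A \<beta> (map_permutation B (inv_into A \<beta>) p) = p"
      using assms inv by (auto intro!: map_permutation_compose_inv simp: bij_betw_def f_inv_into_f)
  qed (use assms inv map_permutation_permutes in blast)+
qed

lemma sdet_reindex:
  assumes "bij_betw \<beta> A B" "finite A"
  shows "sdet B M = sdet A (\<lambda>i j. M (\<beta> i) (\<beta> j))"
proof -
  have inj: "inj_on \<beta> A" using assms by (auto simp: bij_betw_def)
  have "sdet B M = (\<Sum>p | p permutes A. of_int (sign (map_permutation A \<beta> p)) *
          (\<Prod>b\<in>B. M b (map_permutation A \<beta> p b)))"
    unfolding sdet_def
    by (rule sum.reindex_bij_betw[OF bij_betw_map_permutation[OF assms(1)], symmetric])
  also have "\<dots> = sdet A (\<lambda>i j. M (\<beta> i) (\<beta> j))"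
    unfolding sdet_def
  proof (intro sum.cong refl)
    fix p assume "p \<in> {p. p permutes A}"
    then have p: "p permutes A" by simp
    have "(\<Prod>b\<in>B. M b (map_permutation A \<beta> p b)) = (\<Prod>i\<in>A. M (\<beta> i) (map_permutation A \<beta> p (\<beta> i)))"
      by (rule prod.reindex_bij_betw[OF assms(1), symmetric])
    also have "\<dots> = (\<Prod>i\<in>A. M (\<beta> i) (\<beta> (p i)))"
      using inj by (intro prod.cong) (auto simp: map_permutation_apply)
    finally show "of_int (sign (map_permutation A \<beta> p)) * (\<Prod>b\<in>B. M b (map_permutation A \<beta> p b)) =
        of_int (sign p) * (\<Prod>i\<in>A. M (\<beta> i) (\<beta> (p i)))"
      using sign_map_permutation[OF inj p assms(2)] by simp
  qed
  finally show ?thesis .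
qed

lemma det_eq_sdet:
  assumes "A \<in> carrier_mat n n"
  shows "det A = sdet {0..<n} (\<lambda>i j. A $$ (i, j))"
  unfolding det_def'[OF assms] sdet_def by simp

lemma sdet_eq_det:
  assumes "bij_betw \<beta> {0..<n} B"
  shows "sdet B M = det (mat n n (\<lambda>(i, j). M (\<beta> i) (\<beta> j)))"
  by (subst det_eq_sdet[of _ n]) (auto simp: sdet_reindex[OF assms] intro!: sdet_cong)

section \<open>Products, row expansion and principal minors\<close>

lemma sdet_mult:
  assumes "finite B"
  shows "sdet B (\<lambda>b c. \<Sum>x\<in>B. M b x * N x c) = sdet B M * sdet B N"
proof -
  obtain \<beta> :: "nat \<Rightarrow> 'a" where \<beta>: "bij_betw \<beta> {0..<card B} B"
    using assms ex_bij_betw_nat_finite by blast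
  have "(\<Sum>x\<in>B. M b x * N x c) = (\<Sum>i = 0..<card B. M b (\<beta> i) * N (\<beta> i) c)" for b c
    by (rule sum.reindex_bij_betw[OF \<beta>, symmetric])
  then show ?thesis
    unfolding sdet_eq_det[OF \<beta>]
    by (subst det_mult[of _ "card B", symmetric])
      (auto intro!: arg_cong[of _ _ det] eq_matI simp: scalar_prod_def)
qed

text \<open>Every row chooses one of its two summands; \<open>T\<close> records the rows that choose
  \<open>M\<close>.\<close>

lemma sdet_add:
  assumes "finite B"
  shows "sdet B (\<lambda>b c. M b c + N b c) = (\<Sum>T\<in>Pow B. sdet B (\<lambda>b c. if b \<in> T then M b c else N b c))"
proof -
  have "sdet B (\<lambda>b c. M b c + N b c) =
     (\<Sum>p | p permutes B. \<Sum>T\<in>Pow B. of_int (sign p) * (\<Prod>b\<in>B. if b \<in> T then M b (p b) else N b (p b)))"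
    unfolding sdet_def
  proof (intro sum.cong refl)
    fix p
    have "(\<Prod>b\<in>B. M b (p b) + N b (p b)) = (\<Sum>T\<in>Pow B. (\<Prod>b\<in>T. M b (p b)) * (\<Prod>b\<in>B - T. N b (p b)))"
      by (rule prod_add[OF assms])
    also have "\<dots> = (\<Sum>T\<in>Pow B. \<Prod>b\<in>B. if b \<in> T then M b (p b) else N b (p b))"
    proof (intro sum.cong refl)
      fix T assume "T \<in> Pow B"
      then have "B \<inter> T = T" "B \<inter> - T = B - T" by auto
      then show "(\<Prod>b\<in>T. M b (p b)) * (\<Prod>b\<in>B - T. N b (p b)) = (\<Prod>b\<in>B. if b \<in> T then M b (p b) else N b (p b))"
        using prod.If_cases[OF assms, of "\<lambda>b. b \<in> T" "\<lambda>b. M b (p b)" "\<lambda>b. N b (p b)"] by simp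
    qed
    finally show "of_int (sign p) * (\<Prod>b\<in>B. M b (p b) + N b (p b)) =
      (\<Sum>T\<in>Pow B. of_int (sign p) * (\<Prod>b\<in>B. if b \<in> T then M b (p b) else N b (p b)))"
      by (simp add: sum_distrib_left)
  qed
  then show ?thesis
    unfolding sdet_def by (subst (asm) sum.swap)
qed

text \<open>A row with its only entry on the diagonal forces a contributing permutation to fix its
  index, so only the permutations of \<open>S\<close> survive, with the same sign.\<close>

lemma sdet_diagonal_rows:
  assumes "finite B" "S \<subseteq> B"
  shows "sdet B (\<lambda>b c. if b \<in> S then M b c else if b = c then x else 0) = x ^ (card B - card S) * sdet S M"
proof -
  let ?M = "\<lambda>b c. if b \<in> S then M b c else if b = c then x else 0"
  have fS: "finite S" using assms finite_subset by blast
  have z: "(\<Prod>b\<in>B. ?M b (p b)) = 0" if "p permutes B" "\<not> p permutes S" for p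
  proof -
    have "\<exists>b\<in>B - S. p b \<noteq> b"
    proof (rule ccontr)
      assume "\<not> ?thesis"
      then have "p permutes S"
        using that(1) assms by (intro permutes_superset[OF that(1)]) auto
      with that show False by blast
    qed
    then obtain b where "b \<in> B - S" "p b \<noteq> b" by blast
    then show ?thesis using assms by (intro prod_zero) auto
  qed
  have e: "(\<Prod>b\<in>B. ?M b (p b)) = x ^ (card B - card S) * (\<Prod>b\<in>S. M b (p b))" if "p permutes S" for p
  proof -
    have "(\<Prod>b\<in>B. ?M b (p b)) = (\<Prod>b\<in>S. ?M b (p b)) * (\<Prod>b\<in>B - S. ?M b (p b))"
      by (subst prod.subset_diff[OF assms(2,1)]) (rule mult.commute)
    also have "(\<Prod>b\<in>B - S. ?M b (p b)) = (\<Prod>b\<in>B - S. x)"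
      using that by (intro prod.cong) (auto simp: permutes_not_in)
    finally show ?thesis using assms fS by (simp add: card_Diff_subset mult.commute)
  qed
  have "sdet B ?M = (\<Sum>p | p permutes S. of_int (sign p) * (\<Prod>b\<in>B. ?M b (p b)))"
    unfolding sdet_def
    using assms by (intro sum.mono_neutral_right)
      (auto simp: finite_permutations z intro: permutes_subset)
  also have "\<dots> = x ^ (card B - card S) * sdet S M"
    unfolding sdet_def by (auto simp: e sum_distrib_left mult_ac intro!: sum.cong)
  finally show ?thesis .
qed

lemma sdet_smult: "sdet B (\<lambda>b c. x * M b c) = x ^ card B * sdet B M"
  by (cases "finite B") (auto simp: sdet_def prod.distrib sum_distrib_left mult_ac)

lemma sdet_one_add:
  assumes "finite B"
  shows "sdet B (\<lambda>b c. z * M b c + (if b = c then x else 0)) =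
    (\<Sum>S\<in>Pow B. x ^ (card B - card S) * z ^ card S * sdet S M)"
  unfolding sdet_add[OF assms]
  by (intro sum.cong refl) (simp add: sdet_diagonal_rows[OF assms] sdet_smult mult_ac)

section \<open>Coefficients of the characteristic polynomial\<close>

lemma of_int_pCons_hom: "(of_int i :: 'a::comm_ring_1 poly) = [:of_int i:]"
  by (simp add: of_int_poly)

lemma sdet_const_poly: "sdet B (\<lambda>b c. [:M b c:]) = [:sdet B M:]"
proof -
  have [simp]: "(\<Prod>b\<in>A. [:g b:]) = [:prod g A:]" for g :: "'b \<Rightarrow> 'a" and A
    by (induction A rule: infinite_finite_induct) auto
  have [simp]: "(\<Sum>b\<in>A. [:g b:]) = [:sum g A:]" for g :: "('b \<Rightarrow> 'b) \<Rightarrow> 'a" and A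
    by (induction A rule: infinite_finite_induct) auto
  show ?thesis unfolding sdet_def by (simp add: of_int_pCons_hom mult.commute)
qed

lemma minus_one_pCons: "(- 1 :: 'a::comm_ring_1 poly) = [:- 1:]"
  by (simp add: one_pCons)

lemma var_power_mult_const: "[:0, 1:] ^ j * [:a:] = monom (a::'a::comm_ring_1) j"
  by (simp add: monom_altdef)

lemma coeff_sdet_one_sub:
  fixes M :: "'b \<Rightarrow> 'b \<Rightarrow> 'a::comm_ring_1"
  assumes "finite B"
  shows "coeff (sdet B (\<lambda>b c. - [:0, 1:] * [:M b c:] + (if b = c then 1 else 0))) l =
    (- 1) ^ l * (\<Sum>S | S \<subseteq> B \<and> card S = l. sdet S M)"
proof -
  have "coeff (sdet B (\<lambda>b c. - [:0, 1:] * [:M b c:] + (if b = c then 1 else 0))) l =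
    (\<Sum>S\<in>Pow B. coeff ([:0, 1:] ^ card S * [:(- 1) ^ card S * sdet S M:]) l)"
    unfolding sdet_one_add[OF assms] coeff_sum
  proof (intro sum.cong refl arg_cong2[of _ _ _ _ coeff])
    fix S :: "'b set"
    have "(- [:0, 1:]) ^ card S = [:0, 1::'a:] ^ card S * [:(- 1) ^ card S:]"
      by (subst power_minus) (simp add: minus_one_pCons mult.commute flip: poly_const_pow)
    then show "1 ^ (card B - card S) * (- [:0, 1:]) ^ card S * sdet S (\<lambda>a b. [:M a b:]) =
         [:0, 1:] ^ card S * [:(- 1) ^ card S * sdet S M:]"
      by (simp add: sdet_const_poly mult_ac)
  qed
  also have "\<dots> = (\<Sum>S\<in>Pow B. if card S = l then (- 1) ^ l * sdet S M else 0)"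
    unfolding var_power_mult_const by (intro sum.cong) auto
  also have "\<dots> = (\<Sum>S | S \<subseteq> B \<and> card S = l. (- 1) ^ l * sdet S M)"
    using assms by (subst sum.inter_filter[symmetric]) (auto intro!: sum.cong)
  finally show ?thesis by (simp add: sum_distrib_left)
qed

lemma coeff_sdet_var_sub:
  fixes M :: "'b \<Rightarrow> 'b \<Rightarrow> 'a::comm_ring_1"
  assumes "finite B" "l \<le> card B"
  shows "coeff (sdet B (\<lambda>b c. - 1 * [:M b c:] + (if b = c then [:0, 1:] else 0))) (card B - l) =
    (- 1) ^ l * (\<Sum>S | S \<subseteq> B \<and> card S = l. sdet S M)"
proof -
  have "coeff (sdet B (\<lambda>b c. - 1 * [:M b c:] + (if b = c then [:0, 1:] else 0))) (card B - l) =
    (\<Sum>S\<in>Pow B. coeff ([:0, 1:] ^ (card B - card S) * [:(- 1) ^ card S * sdet S M:]) (card B - l))"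
    unfolding sdet_one_add[OF assms(1)] coeff_sum
  proof (intro sum.cong refl arg_cong2[of _ _ _ _ coeff])
    fix S :: "'b set"
    have "(- 1) ^ card S = [:(- 1 :: 'a) ^ card S:]"
      by (simp add: minus_one_pCons flip: poly_const_pow)
    then show "[:0, 1:] ^ (card B - card S) * (- 1) ^ card S * sdet S (\<lambda>a b. [:M a b:]) =
         [:0, 1:] ^ (card B - card S) * [:(- 1) ^ card S * sdet S M:]"
      by (simp add: sdet_const_poly mult_ac)
  qed
  also have "\<dots> = (\<Sum>S\<in>Pow B. if card S = l then (- 1) ^ l * sdet S M else 0)"
    unfolding var_power_mult_const
  proof (intro sum.cong refl)
    fix S assume "S \<in> Pow B"
    then have "card S \<le> card B" using assms by (auto intro: card_mono)
    then show "coeff (monom ((- 1) ^ card S * sdet S M) (card B - card S)) (card B - l) =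
         (if card S = l then (- 1) ^ l * sdet S M else 0)" using assms by auto
  qed
  also have "\<dots> = (\<Sum>S | S \<subseteq> B \<and> card S = l. (- 1) ^ l * sdet S M)"
    using assms by (subst sum.inter_filter[symmetric]) (auto intro!: sum.cong)
  finally show ?thesis by (simp add: sum_distrib_left)
qed

text \<open>Reversal of the characteristic polynomial: the coefficient of \<open>t^(n - l)\<close>
  in \<open>det (t - M)\<close> and that of \<open>u^l\<close> in \<open>det (1 - u M)\<close> are
  both \<open>(- 1) ^ l\<close> times the sum of the principal minors of size
  \<open>l\<close>.\<close>

lemma char_coeff_eq:
  fixes A :: "'a::field mat"
  assumes A: "A \<in> carrier_mat n n" and "l \<le> n" and \<beta>: "bij_betw \<beta> {0..<n} B"
    and M: "\<And>i j. i < n \<Longrightarrow> j < n \<Longrightarrow> A $$ (i, j) = M (\<beta> i) (\<beta> j)"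
  shows "char_coeff n l A = coeff (sdet B (\<lambda>b c. - [:0, 1:] * [:M b c:] + (if b = c then 1 else 0))) l"
proof -
  have fB: "finite B" and cB: "card B = n" using bij_betw_finite[OF \<beta>] bij_betw_same_card[OF \<beta>] by auto
  have inj: "inj_on \<beta> {0..<n}" using \<beta> by (simp add: bij_betw_def)
  have "char_poly A = sdet B (\<lambda>b c. - 1 * [:M b c:] + (if b = c then [:0, 1:] else 0))"
    unfolding char_poly_def sdet_eq_det[OF \<beta>] char_poly_matrix_def
    using A by (intro arg_cong[of _ _ det] eq_matI) (auto simp: M inj_on_eq_iff[OF inj])
  then show ?thesis
    unfolding char_coeff_def using coeff_sdet_var_sub[OF fB, of l M] coeff_sdet_one_sub[OF fB, of M l] assms cB
    by simp
qed

section \<open>Perturbations of a nilpotent Jordan matrix\<close>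

lemma sdet_scale_columns: "sdet A (\<lambda>i j. f j * M i j) = prod f A * sdet A M"
proof -
  have "(\<Prod>i\<in>A. f (p i)) = prod f A" if "p permutes A" for p
    using prod.permute[OF that, of f] by (simp add: comp_def)
  then show ?thesis
    unfolding sdet_def sum_distrib_left by (intro sum.cong) (auto simp: prod.distrib mult_ac)
qed

lemma sdet_sum_columns:
  assumes "finite A" "\<And>j. j \<in> A \<Longrightarrow> finite (S j)"
  shows "sdet A (\<lambda>i j. \<Sum>x\<in>S j. c i j x) = (\<Sum>g\<in>PiE A S. sdet A (\<lambda>i j. c i j (g j)))"
proof -
  have "(\<Prod>i\<in>A. \<Sum>x\<in>S (p i). c i (p i) x) = (\<Sum>g\<in>PiE A S. \<Prod>i\<in>A. c i (p i) (g (p i)))"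
    if p: "p permutes A" for p
  proof -
    have i: "inv_into UNIV p (p x) = x" for x using permutes_inverses[OF p] by simp
    \<comment> \<open>Reindexing by the column \<open>j = p i\<close> makes the ranges of the inner
      sums independent of \<open>p\<close>, so the choices \<open>g\<close> can later be moved
      outside the sum over permutations.\<close>
    have "(\<Prod>i\<in>A. \<Sum>x\<in>S (p i). c i (p i) x) = (\<Prod>j\<in>A. \<Sum>x\<in>S j. c (inv_into UNIV p j) j x)"
      by (subst (2) prod.permute[OF p]) (simp add: i)
    also have "\<dots> = (\<Sum>g\<in>PiE A S. \<Prod>j\<in>A. c (inv_into UNIV p j) j (g j))"
      by (rule prod_sum_PiE) (use assms in auto)
    also have "\<dots> = (\<Sum>g\<in>PiE A S. \<Prod>i\<in>A. c i (p i) (g (p i)))"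
      by (subst prod.permute[OF p]) (simp add: i)
    finally show ?thesis .
  qed
  then have "sdet A (\<lambda>i j. \<Sum>x\<in>S j. c i j x) =
    (\<Sum>p | p permutes A. \<Sum>g\<in>PiE A S. of_int (sign p) * (\<Prod>i\<in>A. c i (p i) (g (p i))))"
    unfolding sdet_def by (intro sum.cong) (auto simp: sum_distrib_left)
  also have "\<dots> = (\<Sum>g\<in>PiE A S. sdet A (\<lambda>i j. c i j (g j)))"
    unfolding sdet_def by (rule sum.swap)
  finally show ?thesis .
qed

text \<open>Once a summand is chosen in each column, the power of the variable depends on the column
  alone and factors out of the determinant; the exponents of the columns add up.\<close>

lemma coeff_sdet_shifted:
  fixes c :: "'b \<Rightarrow> 'b \<Rightarrow> nat \<Rightarrow> 'a::comm_ring_1"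
  assumes "finite A"
  shows "coeff (sdet A (\<lambda>i j. \<Sum>x\<in>{p j..q j}. [:0, 1:] ^ (x - p j) * [:c i j x:])) r =
    (\<Sum>g | g \<in> (\<Pi>\<^sub>E j\<in>A. {p j..q j}) \<and> (\<Sum>j\<in>A. g j - p j) = r. sdet A (\<lambda>i j. c i j (g j)))"
proof -
  have fin: "finite (\<Pi>\<^sub>E j\<in>A. {p j..q j})" using assms by (intro finite_PiE) auto
  have m: "sdet A (\<lambda>i j. [:0, 1:] ^ (g j - p j) * [:c i j (g j):]) =
      monom (sdet A (\<lambda>i j. c i j (g j))) (\<Sum>j\<in>A. g j - p j)" for g
    by (simp only: sdet_scale_columns sdet_const_poly) (simp only: power_sum[symmetric] var_power_mult_const)
  have "coeff (sdet A (\<lambda>i j. \<Sum>x\<in>{p j..q j}. [:0, 1:] ^ (x - p j) * [:c i j x:])) r =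
    (\<Sum>g\<in>(\<Pi>\<^sub>E j\<in>A. {p j..q j}). coeff (monom (sdet A (\<lambda>i j. c i j (g j))) (\<Sum>j\<in>A. g j - p j)) r)"
    by (subst sdet_sum_columns) (simp_all only: assms m coeff_sum finite_atLeastAtMost)
  also have "\<dots> = (\<Sum>g\<in>(\<Pi>\<^sub>E j\<in>A. {p j..q j}).
      if (\<Sum>j\<in>A. g j - p j) = r then sdet A (\<lambda>i j. c i j (g j)) else 0)"
    by (intro sum.cong) auto
  also have "\<dots> = (\<Sum>g | g \<in> (\<Pi>\<^sub>E j\<in>A. {p j..q j}) \<and> (\<Sum>j\<in>A. g j - p j) = r. sdet A (\<lambda>i j. c i j (g j)))"
    using fin by (subst sum.inter_filter[symmetric]) (auto intro!: sum.cong)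
  finally show ?thesis .
qed

text \<open>Induction by removing the largest element: \<open>J\<close> lies in
  \<open>{1..Max J}\<close>, hence \<open>card J \<le> Max J\<close> and
  \<open>d (Max J) \<le> d (card J)\<close>.\<close>

lemma sum_le_initial:
  fixes d :: "nat \<Rightarrow> nat"
  assumes "\<And>i j. 1 \<le> i \<Longrightarrow> i \<le> j \<Longrightarrow> j \<le> k \<Longrightarrow> d j \<le> d i" "J \<subseteq> {1..k}"
  shows "sum d J \<le> sum d {1..card J}"
  using assms(2)
proof (induction "card J" arbitrary: J)
  case 0
  then have "J = {}" using finite_subset by fastforce
  then show ?case by simp
next
  case (Suc c)
  then have fin: "finite J" and ne: "J \<noteq> {}" using finite_subset by fastforce+
  then have M: "Max J \<in> J" "J \<subseteq> {1..Max J}" using Suc.prems by auto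
  have "card J \<le> Max J" using card_mono[OF _ M(2)] by simp
  then have "d (Max J) \<le> d (card J)" using M Suc assms(1)[of "card J" "Max J"] by auto
  moreover have "sum d (J - {Max J}) \<le> sum d {1..card (J - {Max J})}"
    using Suc M fin by (intro Suc.hyps) auto
  moreover have "{1..card J} = insert (card J) {1..c}" using Suc(2) by auto
  ultimately show ?case
    using M fin Suc(2)[symmetric] by (subst sum.remove[OF fin M(1)]) auto
qed

section \<open>Determinants mixing rows of 1 - u e and - u Y\<close>

locale jordan_type =
  fixes k :: nat and d :: "nat \<Rightarrow> nat"
  assumes antimono: "\<And>i j. 1 \<le> i \<Longrightarrow> i \<le> j \<Longrightarrow> j \<le> k \<Longrightarrow> d j \<le> d i"
begin

definition B :: "(nat \<times> nat) set" where "B = (SIGMA i:{1..k}. {0..d i})"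

text \<open>For \<open>r \<le> k\<close>, the total size of the \<open>r\<close> largest Jordan
  blocks.\<close>

definition L :: "nat \<Rightarrow> nat" where "L r = (\<Sum>i=1..r. d i + 1)"

text \<open>The matrix of \<open>e\<close> in the basis \<open>e^s w_i\<close>, labelled by the
  pairs \<open>(i, s)\<close>.\<close>

definition shift :: "nat \<times> nat \<Rightarrow> nat \<times> nat \<Rightarrow> 'a::comm_ring_1" where
  "shift b c = (if fst b = fst c \<and> snd b = Suc (snd c) then 1 else 0)"

text \<open>The matrix of the inverse of \<open>1 - u e\<close>, a geometric series that is finite
  because \<open>e\<close> is nilpotent.\<close>

definition geom :: "nat \<times> nat \<Rightarrow> nat \<times> nat \<Rightarrow> 'a::comm_ring_1 poly" where
  "geom b c = (if fst b = fst c \<and> snd c \<le> snd b then [:0, 1:] ^ (snd b - snd c) else 0)"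

text \<open>The matrix with rows \<open>- u Y\<close> on \<open>T\<close> and \<open>1 - u e\<close> elsewhere, where \<open>u\<close> is the polynomial variable.\<close>

definition mixed :: "(nat \<times> nat \<Rightarrow> nat \<times> nat \<Rightarrow> 'a::comm_ring_1) \<Rightarrow> (nat \<times> nat) set
    \<Rightarrow> nat \<times> nat \<Rightarrow> nat \<times> nat \<Rightarrow> 'a poly" where
  "mixed Y T b c = (if b \<in> T then - [:0, 1:] * [:Y b c:] else - [:0, 1:] * [:shift b c:] + (if b = c then 1 else 0))"

text \<open>The part of degree \<open>D\<close> in \<open>Y\<close> of the coefficient of
  \<open>u^l\<close> in \<open>det (1 - u (e + Y))\<close>: the rows in \<open>T\<close> are linear
  in \<open>Y\<close>, and the others do not involve \<open>Y\<close>.\<close>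

definition deg_part :: "nat \<Rightarrow> nat \<Rightarrow> (nat \<times> nat \<Rightarrow> nat \<times> nat \<Rightarrow> 'a::comm_ring_1) \<Rightarrow> 'a" where
  "deg_part D l Y = (\<Sum>T | T \<subseteq> B \<and> card T = D. coeff (sdet B (mixed Y T)) l)"

lemma finite_B: "finite B" by (simp add: B_def)

lemma sum_le_L: "J \<subseteq> {1..k} \<Longrightarrow> (\<Sum>i\<in>J. d i + 1) \<le> L (card J)"
  unfolding L_def by (rule sum_le_initial[of k]) (use antimono in auto)

lemma L_mono: "r \<le> r' \<Longrightarrow> L r \<le> L r'"
  unfolding L_def by (intro sum_mono2) auto

lemma le_L: "r \<le> L r"
  unfolding L_def using sum_mono[of "{1..r}" "\<lambda>_. 1" "\<lambda>i. d i + 1"] by simp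

lemma card_B: "card B = L k" by (simp add: B_def L_def)

lemma sum_mixed:
  assumes "finite B"
  shows "(\<Sum>D\<le>card B. deg_part D l Y) =
    coeff (sdet B (\<lambda>b c. - [:0, 1:] * [:shift b c + Y b c:] + (if b = c then 1 else 0))) l"
proof -
  have "sdet B (\<lambda>b c. - [:0, 1:] * [:shift b c + Y b c:] + (if b = c then 1 else 0)) =
    sdet B (\<lambda>b c. - [:0, 1:] * [:Y b c:] + (- [:0, 1:] * [:shift b c:] + (if b = c then 1 else 0)))"
    by (intro sdet_cong) simp
  also have "\<dots> = (\<Sum>T\<in>Pow B. sdet B (mixed Y T))"
    by (subst sdet_add[OF assms]) (simp add: mixed_def[abs_def])
  finally have "coeff (sdet B (\<lambda>b c. - [:0, 1:] * [:shift b c + Y b c:] + (if b = c then 1 else 0))) l =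
    (\<Sum>T\<in>Pow B. coeff (sdet B (mixed Y T)) l)" by (simp add: coeff_sum)
  also have "\<dots> = (\<Sum>D\<le>card B. \<Sum>T | T \<in> Pow B \<and> card T = D. coeff (sdet B (mixed Y T)) l)"
    using assms by (intro sum.group[symmetric]) (auto intro: card_mono)
  finally show ?thesis by (simp add: deg_part_def)
qed

text \<open>A chain outside \<open>J\<close> has no room to move down: its bottom has nothing below
  it and stays fixed, and once height \<open>a\<close> is occupied by its own image, injectivity
  keeps height \<open>a + 1\<close> from descending to it.\<close>

lemma permutes_no_descent:
  assumes p: "p permutes B"
    and step: "\<And>b. b \<in> B \<Longrightarrow> fst b \<notin> J \<Longrightarrow> p b = b \<or> (fst b = fst (p b) \<and> snd b = Suc (snd (p b)))"
    and "b \<in> B" "fst b \<notin> J"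
  shows "p b = b"
  using assms(3,4)
proof (induction "snd b" arbitrary: b)
  case 0
  then show ?case using step[of b] by auto
next
  case (Suc a)
  let ?b = "(fst b, a)"
  have "?b \<in> B" using Suc by (auto simp: B_def)
  then have "p ?b = ?b" using Suc by (intro Suc(1)) auto
  moreover have "?b \<noteq> b" using Suc(2) by (metis n_not_Suc_n snd_conv)
  ultimately have "p b \<noteq> ?b" using permutes_inj[OF p] by (metis injD)
  then show ?case using step[of b] Suc by (metis Suc_inject prod.collapse)
qed

text \<open>Outside \<open>J\<close> all rows are rows of \<open>1 - u e\<close>, whose nonzero
  entries either lie on the diagonal or lower the height by one. By
  \<open>permutes_no_descent\<close> only permutations that are trivial there survive, and these
  rows contribute the factor 1. The Boolean \<open>p'\<close> names this condition.\<close>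

lemma prod_free_rows:
  assumes p: "p permutes B" and J: "fst ` T \<subseteq> J" "p' = (\<forall>b\<in>B. fst b \<notin> J \<longrightarrow> p b = b)"
  shows "(\<Prod>b\<in>B. mixed Y T b (p b)) = (if p' then \<Prod>b | b \<in> B \<and> fst b \<in> J. mixed Y T b (p b) else 0)"
proof (cases p')
  case True
  have "(\<Prod>b\<in>B. mixed Y T b (p b)) =
    (\<Prod>b\<in>{b\<in>B. fst b \<in> J}. mixed Y T b (p b)) * (\<Prod>b\<in>B - {b\<in>B. fst b \<in> J}. mixed Y T b (p b))"
    by (subst prod.subset_diff[of "{b\<in>B. fst b \<in> J}" B]) (auto simp: finite_B mult.commute)
  also have "(\<Prod>b\<in>B - {b\<in>B. fst b \<in> J}. mixed Y T b (p b)) = 1"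
  proof (intro prod.neutral ballI)
    fix b assume b: "b \<in> B - {b \<in> B. fst b \<in> J}"
    then have "p b = b" "b \<notin> T" using True J by auto
    then show "mixed Y T b (p b) = 1" by (simp add: mixed_def shift_def)
  qed
  finally show ?thesis using True by simp
next
  case False
  then obtain b where b: "b \<in> B" "fst b \<notin> J"
    "\<not> (p b = b \<or> (fst b = fst (p b) \<and> snd b = Suc (snd (p b))))"
    using permutes_no_descent[OF p, of J] J by blast
  then have "mixed Y T b (p b) = 0" using J by (auto simp: mixed_def shift_def)
  then have "(\<Prod>b\<in>B. mixed Y T b (p b)) = 0" using b finite_B by (intro prod_zero) auto
  with False show ?thesis by simp
qed

lemma degree_mixed: "degree (mixed Y T b c) \<le> 1"
  by (auto simp: mixed_def intro!: degree_add_le split: if_splits)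

text \<open>Rows in blocks that \<open>T\<close> does not meet contribute only the factor 1, and
  every other row has entries of degree at most 1.\<close>

lemma degree_sdet_mixed: "degree (sdet B (mixed Y T)) \<le> card {b\<in>B. fst b \<in> fst ` T}"
  unfolding sdet_def
proof (intro degree_sum_le)
  fix p assume "p \<in> {p. p permutes B}"
  then have p: "p permutes B" by simp
  have "degree (\<Prod>b | b \<in> B \<and> fst b \<in> fst ` T. mixed Y T b (p b)) \<le>
    (\<Sum>b | b \<in> B \<and> fst b \<in> fst ` T. degree (mixed Y T b (p b)))"
    using degree_prod_sum_le[of "{b\<in>B. fst b \<in> fst ` T}"] finite_B by (simp add: comp_def)
  also have "\<dots> \<le> (\<Sum>b | b \<in> B \<and> fst b \<in> fst ` T. 1)" by (intro sum_mono degree_mixed)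
  finally have "degree (\<Prod>b\<in>B. mixed Y T b (p b)) \<le> card {b\<in>B. fst b \<in> fst ` T}"
    unfolding prod_free_rows[OF p order.refl refl] by simp
  then show "degree (of_int (sign p) * (\<Prod>b\<in>B. mixed Y T b (p b))) \<le> card {b\<in>B. fst b \<in> fst ` T}"
    by (intro order.trans[OF degree_mult_le]) (simp add: of_int_pCons_hom)
qed (simp add: finite_B finite_permutations)

lemma sdet_mixed_empty: "sdet B (mixed Y {}) = 1"
proof -
  have "sdet B (mixed Y {}) = (\<Sum>p\<in>{id}. of_int (sign p) * (\<Prod>b\<in>B. mixed Y {} b (p b)))"
    unfolding sdet_def
  proof (intro sum.mono_neutral_right ballI)
    fix p assume "p \<in> {p. p permutes B} - {id}"
    then have p: "p permutes B" "p \<noteq> id" by auto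
    then obtain b where "b \<in> B" "p b \<noteq> b" by (metis eq_id_iff permutes_not_in)
    then show "of_int (sign p) * (\<Prod>b\<in>B. mixed Y {} b (p b)) = 0"
      by (subst prod_free_rows[OF p(1), of _ "{}"]) auto
  qed (auto simp: finite_B finite_permutations permutes_id)
  also have "\<dots> = 1"
    using prod_free_rows[OF permutes_id, of "{}" "{}" _ Y] by (simp add: sign_id)
  finally show ?thesis .
qed

text \<open>Only \<open>x = b\<close> and the label one step below \<open>b\<close> contribute, and
  the two geometric terms \<open>u^r\<close> and \<open>u * u^(r - 1)\<close> cancel unless
  \<open>b = c\<close>.\<close>

lemma sum_mixed_geom_free:
  assumes "b \<in> B" "c \<in> B"
  shows "(\<Sum>x\<in>B. (- [:0, 1:] * [:shift b x:] + (if b = x then 1 else 0)) * geom x c) = (if b = c then 1 else 0 :: 'a::comm_ring_1 poly)"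
proof -
  have e: "(- [:0, 1:] * [:shift b x:] + (if b = x then 1 else 0)) * geom x c =
     (if x = b then geom x c else 0) - (if snd b > 0 \<and> x = (fst b, snd b - 1) then [:0, 1:] * (geom x c :: 'a poly) else 0)" for x
    by (cases x; cases b) (auto simp: shift_def)
  have m: "(fst b, snd b - 1) \<in> B" if "snd b > 0" using assms that by (auto simp: B_def)
  have "(\<Sum>x\<in>B. (- [:0, 1:] * [:shift b x:] + (if b = x then 1 else 0)) * geom x c) =
     geom b c - (if snd b > 0 then [:0, 1:] * geom (fst b, snd b - 1) c else (0 :: 'a poly))"
    unfolding e sum_subtractf using assms m finite_B by (cases "snd b > 0") (simp_all add: sum.delta)
  also have "\<dots> = (if b = c then 1 else 0)"
  proof (cases "fst b = fst c \<and> snd c < snd b")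
    case True
    then have "snd b - snd c = Suc (snd b - 1 - snd c)" by linarith
    then show ?thesis using True by (auto simp: geom_def)
  next
    case False
    then show ?thesis by (cases b; cases c) (auto simp: geom_def)
  qed
  finally show ?thesis .
qed

text \<open>By multiplicativity: \<open>1 - u e\<close> has determinant 1, and its product with
  \<open>geom\<close> is the identity. The zero matrix only fills the argument of
  \<open>mixed\<close>, since \<open>T\<close> is empty.\<close>

lemma sdet_geom: "sdet B geom = (1 :: 'a::comm_ring_1 poly)"
proof -
  have "sdet B (\<lambda>b c. \<Sum>x\<in>B. mixed (\<lambda>_ _. 0::'a) {} b x * geom x c) = sdet B (\<lambda>b c. if b = c then 1 else 0)"
    by (intro sdet_cong) (simp only: mixed_def empty_iff if_False sum_mixed_geom_free)
  also have "\<dots> = 1"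
    using sdet_diagonal_rows[of B "{}" "\<lambda>_ _. 0" "1 :: 'a poly"] finite_B by (simp add: sdet_def sign_id)
  finally show ?thesis
    unfolding sdet_mult[OF finite_B] sdet_mixed_empty by simp
qed

lemma sum_Y_geom:
  assumes "c \<in> B"
  shows "(\<Sum>x\<in>B. [:Y b x:] * geom x c) = (\<Sum>x\<in>{snd c..d (fst c)}. [:0, 1:] ^ (x - snd c) * [:Y b (fst c, x):])"
proof -
  let ?S = "(\<lambda>x. (fst c, x)) ` {snd c..d (fst c)}"
  have "(\<Sum>x\<in>B. [:Y b x:] * geom x c) = (\<Sum>x\<in>?S. [:Y b x:] * geom x c)"
    using assms by (intro sum.mono_neutral_right) (force simp: B_def geom_def finite_B)+
  also have "\<dots> = (\<Sum>x\<in>{snd c..d (fst c)}. [:0, 1:] ^ (x - snd c) * [:Y b (fst c, x):])"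
    by (subst sum.reindex) (auto simp: inj_on_def geom_def intro!: sum.cong)
  finally show ?thesis .
qed

lemma sdet_mixed:
  assumes T: "T \<subseteq> B"
  shows "sdet B (mixed Y T) = (- [:0, 1:]) ^ card T *
    sdet T (\<lambda>b c. \<Sum>x\<in>{snd c..d (fst c)}. [:0, 1:] ^ (x - snd c) * [:Y b (fst c, x):])"
proof -
  let ?YG = "\<lambda>b c. \<Sum>x\<in>{snd c..d (fst c)}. [:0, 1:] ^ (x - snd c) * [:Y b (fst c, x):]"
  have "sdet B (mixed Y T) = sdet B (\<lambda>b c. \<Sum>x\<in>B. mixed Y T b x * geom x c)"
    unfolding sdet_mult[OF finite_B] sdet_geom by simp
  also have "\<dots> = sdet B (\<lambda>b c. if b \<in> T then - [:0, 1:] * ?YG b c else if b = c then 1 else 0)"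
  proof (rule sdet_cong)
    fix b c assume bc: "b \<in> B" "c \<in> B"
    show "(\<Sum>x\<in>B. mixed Y T b x * geom x c) = (if b \<in> T then - [:0, 1:] * ?YG b c else if b = c then 1 else 0)"
    proof (cases "b \<in> T")
      case True
      then show ?thesis
        by (simp add: mixed_def sum_Y_geom[OF bc(2), symmetric] sum_distrib_left mult.assoc
            sum_negf del: mult_pCons_left mult_pCons_right)
    next
      case False
      then show ?thesis using sum_mixed_geom_free[OF bc] by (simp only: mixed_def if_False)
    qed
  qed
  also have "\<dots> = (- [:0, 1:]) ^ card T * sdet T ?YG"
    by (subst sdet_diagonal_rows[OF finite_B T]) (simp add: sdet_smult del: mult_pCons_left)
  finally show ?thesis .
qed

section \<open>Coefficients of the mixed determinants, one row per block\<close>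

lemma coeff_neg_X_power_mult:
  "coeff ((- [:0, 1:]) ^ m * p) l = (if m \<le> l then (- 1) ^ m * coeff p (l - m) else (0::'a::comm_ring_1))"
proof -
  have "(- [:0, 1:]) ^ m * p = monom 1 m * ([:(- 1) ^ m:] * p)"
    by (subst power_minus) (simp add: minus_one_pCons monom_altdef poly_const_pow mult_ac)
  then show ?thesis by (simp add: coeff_monom_mult)
qed

lemma coeff_sdet_mixed:
  assumes T: "T \<subseteq> B"
  shows "coeff (sdet B (mixed Y T)) l = (if card T \<le> l then (- 1) ^ card T *
    (\<Sum>g | g \<in> (\<Pi>\<^sub>E t\<in>T. {snd t..d (fst t)}) \<and> (\<Sum>t\<in>T. g t - snd t) = l - card T.
      sdet T (\<lambda>b c. Y b (fst c, g c))) else 0)"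
  unfolding sdet_mixed[OF T] coeff_neg_X_power_mult
  using finite_subset[OF T finite_B] by (simp add: coeff_sdet_shifted del: mult_pCons_right)

text \<open>Such a \<open>T\<close> meets at most \<open>card T - 1\<close> blocks, and these
  contain at most \<open>L (card T - 1)\<close> basis vectors; this bounds the degree below
  \<open>l\<close>.\<close>

lemma coeff_sdet_mixed_not_inj:
  assumes T: "T \<subseteq> B" and "\<not> inj_on fst T" and l: "L (card T - 1) < l"
  shows "coeff (sdet B (mixed Y T)) l = 0"
proof (rule coeff_eq_0)
  have fT: "finite T" using T finite_B finite_subset by blast
  have "card {b\<in>B. fst b \<in> fst ` T} = card (SIGMA i:fst ` T. {0..d i})"
    using T by (intro arg_cong[of _ _ card]) (force simp: B_def)
  also have "\<dots> = (\<Sum>i\<in>fst ` T. d i + 1)" using fT by simp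
  also have "\<dots> \<le> L (card (fst ` T))" using T by (intro sum_le_L) (auto simp: B_def)
  also have "card (fst ` T) < card T"
    using assms(2) fT by (metis card_image_le eq_card_imp_inj_on le_neq_implies_less)
  then have "L (card (fst ` T)) \<le> L (card T - 1)" by (intro L_mono) auto
  finally show "degree (sdet B (mixed Y T)) < l"
    using degree_sdet_mixed[of Y T] l by linarith
qed

text \<open>A set that meets each block at most once is the graph of the function giving its height
  in every block that it meets.\<close>

lemma graph_bij:
  "bij_betw (\<lambda>(I, a). (\<lambda>i. (i, a i)) ` I)
    (SIGMA I:{I. I \<subseteq> {1..k} \<and> card I = m}. \<Pi>\<^sub>E i\<in>I. {0..d i})
    {T. T \<subseteq> B \<and> card T = m \<and> inj_on fst T}"
proof (rule bij_betw_byWitness[where f' = "\<lambda>T. (fst ` T, \<lambda>i\<in>fst ` T. snd (inv_into T fst i))"])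
  let ?X = "SIGMA I:{I. I \<subseteq> {1..k} \<and> card I = m}. \<Pi>\<^sub>E i\<in>I. {0..d i}"
  let ?f = "\<lambda>(I, a). (\<lambda>i. (i, a i)) ` I"
  let ?g = "\<lambda>T. (fst ` T, \<lambda>i\<in>fst ` T. snd (inv_into T fst i))"
  have inj: "inj_on fst ((\<lambda>i. (i, a i)) ` I)" for I and a :: "nat \<Rightarrow> nat"
    by (auto simp: inj_on_def)
  show "\<forall>x\<in>?X. ?g (?f x) = x"
  proof
    fix x assume "x \<in> ?X"
    then obtain I a where x: "x = (I, a)" and a: "a \<in> (\<Pi>\<^sub>E i\<in>I. {0..d i})" by blast
    have I: "fst ` (\<lambda>i. (i, a i)) ` I = I" by force
    have "snd (inv_into ((\<lambda>i. (i, a i)) ` I) fst i) = a i" if "i \<in> I" for i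
      using inv_into_f_f[OF inj, of "(i, a i)" a I] that by simp
    then have "(\<lambda>i\<in>I. snd (inv_into ((\<lambda>i. (i, a i)) ` I) fst i)) = a"
      using a by (intro extensionalityI[of _ I]) (simp_all add: PiE_def)
    then show "?g (?f x) = x" by (simp only: x prod.case I)
  qed
  show "\<forall>T\<in>{T. T \<subseteq> B \<and> card T = m \<and> inj_on fst T}. ?f (?g T) = T"
  proof
    fix T assume "T \<in> {T. T \<subseteq> B \<and> card T = m \<and> inj_on fst T}"
    then have "(\<lambda>t. (fst t, snd (inv_into T fst (fst t)))) ` T = (\<lambda>t. t) ` T"
      by (intro image_cong) auto
    then show "?f (?g T) = T" by (simp add: image_image)
  qed
  show "?f ` ?X \<subseteq> {T. T \<subseteq> B \<and> card T = m \<and> inj_on fst T}"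
    by (auto simp: B_def inj card_image inj_on_def)
  show "?g ` {T. T \<subseteq> B \<and> card T = m \<and> inj_on fst T} \<subseteq> ?X"
  proof (rule image_subsetI)
    fix T assume T: "T \<in> {T. T \<subseteq> B \<and> card T = m \<and> inj_on fst T}"
    have "snd (inv_into T fst i) \<le> d i" if "i \<in> fst ` T" for i
      using T inv_into_into[OF that] f_inv_into_f[OF that] by (auto simp: B_def)
    moreover have "fst ` T \<subseteq> {1..k}" "card (fst ` T) = m"
      using T by (auto simp: B_def card_image)
    ultimately show "?g T \<in> ?X" by auto
  qed
qed

text \<open>
  A factor \<open>\<xi>\<close> jumps from the bottom \<open>a i\<close> of one chain to the top \<open>b (\<sigma> i)\<close> of another one, whereas
  the determinant only sees chains with \<open>a i \<le> b i\<close>.  No other chains occur when \<open>l\<close> is this large.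
\<close>

lemma le_of_sum_eq:
  assumes I: "I \<subseteq> {1..k}" "card I = m" and l: "m \<le> l" "L (m - 1) < l"
    and ab: "\<forall>i\<in>I. a i \<le> d i" "\<forall>i\<in>I. b i \<le> d i" "sum b I = sum a I + (l - m)"
    and x: "x \<in> I"
  shows "a x \<le> b x"
proof (rule ccontr)
  assume n: "\<not> a x \<le> b x"
  let ?J = "I - {x}"
  have fin: "finite I" using I finite_subset by blast
  have c: "card ?J = m - 1" "m > 0" using x fin I by (auto simp: card_gt_0_iff)
  have "sum b I = b x + sum b ?J" "sum a I = a x + sum a ?J" using fin x by (auto simp: sum.remove)
  \<comment> \<open>A descent in block \<open>x\<close> must be made up by the other
    \<open>m - 1\<close> blocks, whose heights add up to at most \<open>L (m - 1) - (m - 1)\<close>,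
    which is at most \<open>l - m\<close>.\<close>
  then have "sum b ?J \<ge> 1 + (l - m)" using ab(3) n by linarith
  moreover have "sum b ?J \<le> sum d ?J" using ab by (intro sum_mono) auto
  moreover have "sum d ?J + (m - 1) \<le> L (m - 1)"
  proof -
    have "(\<Sum>i\<in>?J. d i + 1) \<le> L (card ?J)" using I by (intro sum_le_L) auto
    moreover have "(\<Sum>i\<in>?J. d i + 1) = sum d ?J + card ?J" by (simp only: sum.distrib) simp
    ultimately show ?thesis using c by simp
  qed
  ultimately show False using l c by linarith
qed

lemma deg_part_eq_sum:
  assumes l: "m \<le> l" "L (m - 1) < l"
  shows "deg_part m l Y = (- 1) ^ m * (\<Sum>I | I \<subseteq> {1..k} \<and> card I = m.
    \<Sum>(a, b) | a \<in> (\<Pi>\<^sub>E i\<in>I. {0..d i}) \<and> b \<in> (\<Pi>\<^sub>E i\<in>I. {0..d i}) \<and> sum b I = sum a I + (l - m).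
      sdet I (\<lambda>i j. Y (i, a i) (j, b j)))"
proof -
  let ?I = "{I. I \<subseteq> {1..k} \<and> card I = m}"
  have "deg_part m l Y = (\<Sum>T | T \<subseteq> B \<and> card T = m \<and> inj_on fst T. coeff (sdet B (mixed Y T)) l)"
    unfolding deg_part_def using l
    by (intro sum.mono_neutral_right) (auto simp: finite_B coeff_sdet_mixed_not_inj)
  also have "\<dots> = (\<Sum>(I, a)\<in>(SIGMA I:?I. \<Pi>\<^sub>E i\<in>I. {0..d i}). coeff (sdet B (mixed Y ((\<lambda>i. (i, a i)) ` I))) l)"
    by (subst sum.reindex_bij_betw[OF graph_bij, symmetric]) (simp add: case_prod_unfold)
  also have "\<dots> = (\<Sum>I\<in>?I. \<Sum>a\<in>(\<Pi>\<^sub>E i\<in>I. {0..d i}). coeff (sdet B (mixed Y ((\<lambda>i. (i, a i)) ` I))) l)"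
    by (subst sum.Sigma) (auto intro!: finite_PiE intro: finite_subset)
  also have "\<dots> = (\<Sum>I\<in>?I. (- 1) ^ m * (\<Sum>(a, b) | a \<in> (\<Pi>\<^sub>E i\<in>I. {0..d i}) \<and> b \<in> (\<Pi>\<^sub>E i\<in>I. {0..d i}) \<and> sum b I = sum a I + (l - m).
      sdet I (\<lambda>i j. Y (i, a i) (j, b j))))"
  proof (intro sum.cong refl)
    fix I assume "I \<in> ?I"
    then have I: "I \<subseteq> {1..k}" "card I = m" by auto
    then have fI: "finite I" using finite_subset by blast
    have fin: "finite (\<Pi>\<^sub>E i\<in>I. {0..d i})" using fI by (intro finite_PiE) auto
    have fb: "finite {b. b \<in> (\<Pi>\<^sub>E i\<in>I. {a i..d i}) \<and> (\<Sum>i\<in>I. b i - a i) = l - m}" for a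
      by (rule finite_subset[OF _ finite_PiE[of I "\<lambda>i. {a i..d i}"]]) (use fI in auto)
    have "coeff (sdet B (mixed Y ((\<lambda>i. (i, a i)) ` I))) l = (- 1) ^ m *
      (\<Sum>b | b \<in> (\<Pi>\<^sub>E i\<in>I. {a i..d i}) \<and> (\<Sum>i\<in>I. b i - a i) = l - m. sdet I (\<lambda>i j. Y (i, a i) (j, b j)))"
      if a: "a \<in> (\<Pi>\<^sub>E i\<in>I. {0..d i})" for a
    proof -
      let ?T = "(\<lambda>i. (i, a i)) ` I"
      have b: "bij_betw (\<lambda>i. (i, a i)) I ?T" by (auto simp: bij_betw_def inj_on_def)
      have T: "?T \<subseteq> B" "card ?T = m" using I a bij_betw_same_card[OF b] by (auto simp: B_def)
      show ?thesis
        unfolding sdet_mixed[OF T(1)] coeff_neg_X_power_mult sdet_reindex[OF b fI] T(2)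
        using l coeff_sdet_shifted[OF fI, where p = a and q = d and r = "l - m"
            and c = "\<lambda>i j x. Y (i, a i) (j, x)"]
        by (simp del: mult_pCons_right)
    qed
    then have "(\<Sum>a\<in>(\<Pi>\<^sub>E i\<in>I. {0..d i}). coeff (sdet B (mixed Y ((\<lambda>i. (i, a i)) ` I))) l) =
      (- 1) ^ m * (\<Sum>a\<in>(\<Pi>\<^sub>E i\<in>I. {0..d i}). \<Sum>b | b \<in> (\<Pi>\<^sub>E i\<in>I. {a i..d i}) \<and> (\<Sum>i\<in>I. b i - a i) = l - m.
        sdet I (\<lambda>i j. Y (i, a i) (j, b j)))"
      by (simp add: sum_distrib_left)
    also have "(\<Sum>a\<in>(\<Pi>\<^sub>E i\<in>I. {0..d i}). \<Sum>b | b \<in> (\<Pi>\<^sub>E i\<in>I. {a i..d i}) \<and> (\<Sum>i\<in>I. b i - a i) = l - m.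
        sdet I (\<lambda>i j. Y (i, a i) (j, b j))) =
      (\<Sum>(a, b)\<in>(SIGMA a:(\<Pi>\<^sub>E i\<in>I. {0..d i}). {b. b \<in> (\<Pi>\<^sub>E i\<in>I. {a i..d i}) \<and> (\<Sum>i\<in>I. b i - a i) = l - m}).
        sdet I (\<lambda>i j. Y (i, a i) (j, b j)))"
      by (rule sum.Sigma[OF fin]) (use fb in blast)
    also have "(SIGMA a:(\<Pi>\<^sub>E i\<in>I. {0..d i}). {b. b \<in> (\<Pi>\<^sub>E i\<in>I. {a i..d i}) \<and> (\<Sum>i\<in>I. b i - a i) = l - m}) =
      {(a, b). a \<in> (\<Pi>\<^sub>E i\<in>I. {0..d i}) \<and> b \<in> (\<Pi>\<^sub>E i\<in>I. {0..d i}) \<and> sum b I = sum a I + (l - m)}"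
    proof -
      \<comment> \<open>With truncated subtraction the sum of the differences is the difference of
        the sums only if \<open>a\<close> lies below \<open>b\<close>. The interval for
        \<open>b\<close> gives this in one direction, \<open>le_of_sum_eq\<close> in the
        other.\<close>
      have "b \<in> (\<Pi>\<^sub>E i\<in>I. {a i..d i}) \<and> (\<Sum>i\<in>I. b i - a i) = l - m \<longleftrightarrow>
        b \<in> (\<Pi>\<^sub>E i\<in>I. {0..d i}) \<and> sum b I = sum a I + (l - m)"
        if a: "a \<in> (\<Pi>\<^sub>E i\<in>I. {0..d i})" for a b
      proof
        assume ab: "b \<in> (\<Pi>\<^sub>E i\<in>I. {a i..d i}) \<and> (\<Sum>i\<in>I. b i - a i) = l - m"
        then have le: "a i \<le> b i" if "i \<in> I" for i using that by (auto simp: PiE_iff)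
        then have "(\<Sum>i\<in>I. b i - a i) = sum b I - sum a I" by (rule sum_subtractf_nat)
        moreover have "sum a I \<le> sum b I" using le by (rule sum_mono)
        ultimately show "b \<in> (\<Pi>\<^sub>E i\<in>I. {0..d i}) \<and> sum b I = sum a I + (l - m)"
          using ab by (auto simp: PiE_iff)
      next
        assume ab: "b \<in> (\<Pi>\<^sub>E i\<in>I. {0..d i}) \<and> sum b I = sum a I + (l - m)"
        then have le: "a i \<le> b i" if "i \<in> I" for i
          using that a by (intro le_of_sum_eq[OF I l, of a b i]) (auto simp: PiE_iff)
        then have "(\<Sum>i\<in>I. b i - a i) = sum b I - sum a I" by (rule sum_subtractf_nat)
        then show "b \<in> (\<Pi>\<^sub>E i\<in>I. {a i..d i}) \<and> (\<Sum>i\<in>I. b i - a i) = l - m"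
          using ab le by (auto simp: PiE_iff)
      qed
      then show ?thesis by blast
    qed
    finally show "(\<Sum>a\<in>(\<Pi>\<^sub>E i\<in>I. {0..d i}). coeff (sdet B (mixed Y ((\<lambda>i. (i, a i)) ` I))) l) =
      (- 1) ^ m * (\<Sum>(a, b) | a \<in> (\<Pi>\<^sub>E i\<in>I. {0..d i}) \<and> b \<in> (\<Pi>\<^sub>E i\<in>I. {0..d i}) \<and> sum b I = sum a I + (l - m).
      sdet I (\<lambda>i j. Y (i, a i) (j, b j)))" .
  qed
  finally show ?thesis by (simp add: sum_distrib_left)
qed

text \<open>The trace of \<open>\<xi>\<close> with indices \<open>i\<close>, \<open>j\<close>,
  \<open>s\<close> times the endomorphism with matrix \<open>Y\<close>; see
  \<open>mat_trace_xi\<close>.\<close>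

definition diag_sum :: "(nat \<times> nat \<Rightarrow> nat \<times> nat \<Rightarrow> 'a::comm_ring_1) \<Rightarrow> nat \<Rightarrow> nat \<Rightarrow> nat \<Rightarrow> 'a" where
  "diag_sum Y i j s = (\<Sum>a | a \<le> d i \<and> a + s \<le> d j. Y (i, a) (j, a + s))"

text \<open>The substitution \<open>s i = b (p i) - a i\<close> decouples the factors: since
  \<open>p\<close> permutes \<open>I\<close>, the condition on \<open>a\<close> and \<open>b\<close>
  becomes \<open>sum s I = r\<close>, and for fixed \<open>s\<close> the starting heights
  \<open>a i\<close> vary independently, each giving a sum along one diagonal.\<close>

lemma sum_diag_sums:
  assumes I: "I \<subseteq> {1..k}" and p: "p permutes I"
    and Y: "\<And>i j a b. (i, a) \<in> B \<Longrightarrow> (j, b) \<in> B \<Longrightarrow> Y (i, a) (j, b) \<noteq> 0 \<Longrightarrow> a \<le> b \<and> b - a \<in> xi_range d i j"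
  shows "(\<Sum>(a, b) | a \<in> (\<Pi>\<^sub>E i\<in>I. {0..d i}) \<and> b \<in> (\<Pi>\<^sub>E i\<in>I. {0..d i}) \<and> sum b I = sum a I + r.
       \<Prod>i\<in>I. Y (i, a i) (p i, b (p i))) =
    (\<Sum>s | s \<in> (\<Pi>\<^sub>E i\<in>I. xi_range d i (p i)) \<and> sum s I = r. \<Prod>i\<in>I. diag_sum Y i (p i) (s i))"
proof -
  have fI: "finite I" using I finite_subset by blast
  have fin: "finite (\<Pi>\<^sub>E i\<in>I. {0..d i})" using fI by (intro finite_PiE) auto
  have pI: "p i \<in> I \<longleftrightarrow> i \<in> I" "inv_into UNIV p i \<in> I \<longleftrightarrow> i \<in> I" for i
    using p permutes_inv[OF p] by (auto simp: permutes_in_image)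
  have pp: "inv_into UNIV p (p i) = i" "p (inv_into UNIV p i) = i" for i using p by (auto simp: permutes_inverses)
  have sp: "sum f I = (\<Sum>i\<in>I. f (p i))" for f :: "nat \<Rightarrow> nat"
    using sum.permute[OF p, of f] by (simp add: comp_def)
  have fs: "finite {s. s \<in> (\<Pi>\<^sub>E i\<in>I. xi_range d i (p i)) \<and> sum s I = r}"
    using fI by (intro finite_subset[OF _ finite_PiE[of I "\<lambda>i. xi_range d i (p i)"]]) (auto simp: xi_range_def)
  have fa: "finite (\<Pi>\<^sub>E i\<in>I. {a. a \<le> d i \<and> a + s i \<le> d (p i)})" for s :: "nat \<Rightarrow> nat"
    using fI by (intro finite_PiE) auto
  have "(\<Sum>s | s \<in> (\<Pi>\<^sub>E i\<in>I. xi_range d i (p i)) \<and> sum s I = r. \<Prod>i\<in>I. diag_sum Y i (p i) (s i)) =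
    (\<Sum>s | s \<in> (\<Pi>\<^sub>E i\<in>I. xi_range d i (p i)) \<and> sum s I = r.
      \<Sum>a\<in>(\<Pi>\<^sub>E i\<in>I. {a. a \<le> d i \<and> a + s i \<le> d (p i)}). \<Prod>i\<in>I. Y (i, a i) (p i, a i + s i))"
    unfolding diag_sum_def by (intro sum.cong refl prod_sum_PiE fI) auto
  also have "\<dots> = (\<Sum>(s, a)\<in>(SIGMA s:{s. s \<in> (\<Pi>\<^sub>E i\<in>I. xi_range d i (p i)) \<and> sum s I = r}.
      \<Pi>\<^sub>E i\<in>I. {a. a \<le> d i \<and> a + s i \<le> d (p i)}). \<Prod>i\<in>I. Y (i, a i) (p i, a i + s i))"
    using fs fa by (intro sum.Sigma) auto
  also have "\<dots> = (\<Sum>(a, b) | a \<in> (\<Pi>\<^sub>E i\<in>I. {0..d i}) \<and> b \<in> (\<Pi>\<^sub>E i\<in>I. {0..d i}) \<and> sum b I = sum a I + r.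
       \<Prod>i\<in>I. Y (i, a i) (p i, b (p i)))"
  \<comment> \<open>\<open>T'\<close> collects the pairs with a jump outside
    \<open>xi_range\<close>. They come from no \<open>s\<close>, but their products contain an entry
    of \<open>Y\<close> that vanishes by assumption.\<close>
  proof (rule sum.reindex_bij_witness_not_neutral[
      where S' = "{}" and T' = "{(a, b). a \<in> (\<Pi>\<^sub>E i\<in>I. {0..d i}) \<and> b \<in> (\<Pi>\<^sub>E i\<in>I. {0..d i}) \<and> sum b I = sum a I + r \<and>
          \<not> (\<forall>i\<in>I. a i \<le> b (p i) \<and> b (p i) - a i \<in> xi_range d i (p i))}"
        and j = "\<lambda>(s, a). (a, \<lambda>j\<in>I. a (inv_into UNIV p j) + s (inv_into UNIV p j))"
        and i = "\<lambda>(a, b). (\<lambda>i\<in>I. b (p i) - a i, a)"], goal_cases)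
    case 1 then show ?case by simp
  next
    case 2 then show ?case
      by (rule finite_subset[OF _ finite_cartesian_product[OF fin fin]]) auto
  next
    case (3 x)
    then show ?case by (cases x) (auto simp: pI pp fun_eq_iff PiE_iff extensional_def)
  next
    case (4 x)
    then obtain s a where x: "x = (s, a)" and s: "s \<in> (\<Pi>\<^sub>E i\<in>I. xi_range d i (p i))" "sum s I = r"
      and a: "a \<in> (\<Pi>\<^sub>E i\<in>I. {a. a \<le> d i \<and> a + s i \<le> d (p i)})" by auto
    let ?b = "\<lambda>j\<in>I. a (inv_into UNIV p j) + s (inv_into UNIV p j)"
    have "sum ?b I = sum a I + r"
      by (subst sp) (simp add: pI pp sum.distrib s)
    moreover have "?b j \<le> d j" if "j \<in> I" for j
      using a that PiE_mem[OF a, of "inv_into UNIV p j"] by (simp add: pI pp)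
    ultimately show ?case using s a unfolding x
      by (auto simp: PiE_iff pI pp)
  next
    case (5 x)
    obtain a b where x: "x = (a, b)" by fastforce
    have b: "b \<in> (\<Pi>\<^sub>E i\<in>I. {0..d i})" using 5 x by simp
    have le: "\<forall>i\<in>I. a i \<le> b (p i) \<and> b (p i) - a i \<in> xi_range d i (p i)" using 5 x by auto
    have "a (inv_into UNIV p j) \<le> b j" if "j \<in> I" for j
      using le that pI(2)[of j] pp(2)[of j] by metis
    then have "(\<lambda>j\<in>I. a (inv_into UNIV p j) + (\<lambda>i\<in>I. b (p i) - a i) (inv_into UNIV p j)) = b"
      using b by (intro extensionalityI[of _ I]) (simp_all add: PiE_def pI pp)
    then show ?case unfolding x by simp
  next
    case (6 x)
    obtain a b where x: "x = (a, b)" by fastforce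
    have ab: "a \<in> (\<Pi>\<^sub>E i\<in>I. {0..d i})" "b \<in> (\<Pi>\<^sub>E i\<in>I. {0..d i})" "sum b I = sum a I + r"
      using 6 x by simp_all
    have le: "\<forall>i\<in>I. a i \<le> b (p i) \<and> b (p i) - a i \<in> xi_range d i (p i)" using 6 x by auto
    have "(\<Sum>i\<in>I. b (p i) - a i) = (\<Sum>i\<in>I. b (p i)) - sum a I"
      using le by (intro sum_subtractf_nat) auto
    also have "\<dots> = r" using ab(3) sp[of b] by simp
    finally have "(\<Sum>i\<in>I. b (p i) - a i) = r" .
    then show ?case using ab le unfolding x by (auto simp: PiE_iff pI)
  next
    case 7 then show ?case by simp
  next
    case (8 x)
    then obtain a b i where x: "x = (a, b)" and ab: "a \<in> (\<Pi>\<^sub>E i\<in>I. {0..d i})" "b \<in> (\<Pi>\<^sub>E i\<in>I. {0..d i})"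
      and i: "i \<in> I" "\<not> (a i \<le> b (p i) \<and> b (p i) - a i \<in> xi_range d i (p i))" by auto
    have "(i, a i) \<in> B" "(p i, b (p i)) \<in> B" using ab i pI(1)[of i] subsetD[OF I, of i] subsetD[OF I, of "p i"]
      by (auto simp: B_def PiE_iff)
    with i have "Y (i, a i) (p i, b (p i)) = 0" using Y by blast
    then show ?case using i fI unfolding x by (auto intro: prod_zero)
  next
    case (9 x)
    then show ?case by (auto simp: pI pp intro!: prod.cong)
  qed
  finally show ?thesis ..
qed

lemma deg_part_eq_diag_sums:
  assumes l: "m \<le> l" "L (m - 1) < l"
    and Y: "\<And>i j a b. (i, a) \<in> B \<Longrightarrow> (j, b) \<in> B \<Longrightarrow> Y (i, a) (j, b) \<noteq> 0 \<Longrightarrow> a \<le> b \<and> b - a \<in> xi_range d i j"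
  shows "deg_part m l Y = (- 1) ^ m * (\<Sum>I | I \<subseteq> {1..k} \<and> card I = m. \<Sum>p | p permutes I.
    \<Sum>s | s \<in> (\<Pi>\<^sub>E i\<in>I. xi_range d i (p i)) \<and> sum s I = l - m.
      of_int (sign p) * (\<Prod>i\<in>I. diag_sum Y i (p i) (s i)))"
  unfolding deg_part_eq_sum[OF l]
proof (intro arg_cong2[of _ _ _ _ "(*)"] refl sum.cong)
  fix I assume "I \<in> {I. I \<subseteq> {1..k} \<and> card I = m}"
  then have I: "I \<subseteq> {1..k}" by simp
  let ?S = "{(a, b). a \<in> (\<Pi>\<^sub>E i\<in>I. {0..d i}) \<and> b \<in> (\<Pi>\<^sub>E i\<in>I. {0..d i}) \<and> sum b I = sum a I + (l - m)}"
  have "(\<Sum>(a, b)\<in>?S. sdet I (\<lambda>i j. Y (i, a i) (j, b j))) =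
    (\<Sum>p | p permutes I. \<Sum>(a, b)\<in>?S. of_int (sign p) * (\<Prod>i\<in>I. Y (i, a i) (p i, b (p i))))"
    unfolding sdet_def case_prod_unfold by (rule sum.swap)
  also have "\<dots> = (\<Sum>p | p permutes I. of_int (sign p) * (\<Sum>(a, b)\<in>?S. \<Prod>i\<in>I. Y (i, a i) (p i, b (p i))))"
    by (simp add: sum_distrib_left case_prod_unfold)
  also have "\<dots> = (\<Sum>p | p permutes I. of_int (sign p) *
    (\<Sum>s | s \<in> (\<Pi>\<^sub>E i\<in>I. xi_range d i (p i)) \<and> sum s I = l - m. \<Prod>i\<in>I. diag_sum Y i (p i) (s i)))"
    by (intro sum.cong refl arg_cong2[of _ _ _ _ "(*)"] sum_diag_sums[OF I _ Y]) auto
  finally show "(\<Sum>(a, b)\<in>?S. sdet I (\<lambda>i j. Y (i, a i) (j, b j))) =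
    (\<Sum>p | p permutes I. \<Sum>s | s \<in> (\<Pi>\<^sub>E i\<in>I. xi_range d i (p i)) \<and> sum s I = l - m.
      of_int (sign p) * (\<Prod>i\<in>I. diag_sum Y i (p i) (s i)))"
    by (simp add: sum_distrib_left)
qed

end

section \<open>Coordinates with respect to a basis\<close>

locale mat_coords =
  fixes n :: nat and B :: "'b set" and \<beta> :: "nat \<Rightarrow> 'b" and P Q :: "'a::field mat"
  assumes P: "P \<in> carrier_mat n n" and Q: "Q \<in> carrier_mat n n"
    and PQ: "P * Q = 1\<^sub>m n" and QP: "Q * P = 1\<^sub>m n"
    and \<beta>: "bij_betw \<beta> {0..<n} B"
begin

definition co :: "'a mat \<Rightarrow> 'b \<Rightarrow> 'b \<Rightarrow> 'a" where
  "co A b c = (Q * A * P) $$ (inv_into {0..<n} \<beta> b, inv_into {0..<n} \<beta> c)"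

definition bas :: "'b \<Rightarrow> 'a vec" where
  "bas b = col P (inv_into {0..<n} \<beta> b)"

definition of_co :: "('b \<Rightarrow> 'b \<Rightarrow> 'a) \<Rightarrow> 'a mat" where
  "of_co M = P * mat n n (\<lambda>(i, j). M (\<beta> i) (\<beta> j)) * Q"

lemma idx: "b \<in> B \<Longrightarrow> inv_into {0..<n} \<beta> b < n"
  using bij_betw_inv_into[OF \<beta>] by (auto simp: bij_betw_def)

lemma \<beta>_idx: "b \<in> B \<Longrightarrow> \<beta> (inv_into {0..<n} \<beta> b) = b"
  using \<beta> by (auto simp: bij_betw_def f_inv_into_f)

lemma idx_\<beta>: "i < n \<Longrightarrow> inv_into {0..<n} \<beta> (\<beta> i) = i"
  using \<beta> by (auto simp: bij_betw_def inv_into_f_f)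

lemma \<beta>_mem: "i < n \<Longrightarrow> \<beta> i \<in> B"
  using \<beta> by (auto simp: bij_betw_def)

lemma co_\<beta>: "i < n \<Longrightarrow> j < n \<Longrightarrow> co A (\<beta> i) (\<beta> j) = (Q * A * P) $$ (i, j)"
  by (simp add: co_def idx_\<beta>)

lemma sum_idx: "(\<Sum>x\<in>B. g (inv_into {0..<n} \<beta> x)) = (\<Sum>i = 0..<n. g i)"
  by (rule sum.reindex_bij_betw[OF bij_betw_inv_into[OF \<beta>]])

lemma conj_carrier: "A \<in> carrier_mat n n \<Longrightarrow> Q * A * P \<in> carrier_mat n n"
  using P Q by auto

lemma P_conj_Q:
  assumes A: "A \<in> carrier_mat n n"
  shows "P * (Q * A * P) * Q = A"
proof -
  have "P * (Q * A * P) * Q = (P * Q) * A * (P * Q)"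
    using P Q A by (simp add: assoc_mult_mat[of _ n n _ n _ n])
  then show ?thesis using A PQ by simp
qed

lemma Q_conj_P:
  assumes A: "A \<in> carrier_mat n n"
  shows "Q * (P * A * Q) * P = A"
proof -
  have "Q * (P * A * Q) * P = (Q * P) * A * (Q * P)"
    using P Q A by (simp add: assoc_mult_mat[of _ n n _ n _ n])
  then show ?thesis using A QP by simp
qed

lemma of_co_carrier: "of_co M \<in> carrier_mat n n"
  unfolding of_co_def using P Q by auto

lemma co_of_co: "b \<in> B \<Longrightarrow> c \<in> B \<Longrightarrow> co (of_co M) b c = M b c"
  unfolding co_def of_co_def by (subst Q_conj_P) (auto simp: idx \<beta>_idx)

lemma co_eqI:
  assumes "A \<in> carrier_mat n n" "A' \<in> carrier_mat n n"
    and "\<And>b c. b \<in> B \<Longrightarrow> c \<in> B \<Longrightarrow> co A b c = co A' b c"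
  shows "A = A'"
proof -
  have "Q * A * P = Q * A' * P"
  proof (rule eq_matI)
    fix i j assume "i < dim_row (Q * A' * P)" "j < dim_col (Q * A' * P)"
    then have "i < n" "j < n" using P Q by auto
    then show "(Q * A * P) $$ (i, j) = (Q * A' * P) $$ (i, j)"
      using assms(3)[of "\<beta> i" "\<beta> j"] by (simp add: \<beta>_mem co_\<beta>)
  qed (use P Q in auto)
  then show ?thesis using P_conj_Q[OF assms(1)] P_conj_Q[OF assms(2)] by metis
qed

lemma mat_mult_entry:
  "A \<in> carrier_mat n n \<Longrightarrow> A' \<in> carrier_mat n n \<Longrightarrow> i < n \<Longrightarrow> j < n \<Longrightarrow>
    (A * A') $$ (i, j) = (\<Sum>x = 0..<n. A $$ (i, x) * A' $$ (x, j))"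
  by (auto simp: scalar_prod_def intro!: sum.cong)

lemma co_mult:
  assumes A: "A \<in> carrier_mat n n" and A': "A' \<in> carrier_mat n n" and "b \<in> B" "c \<in> B"
  shows "co (A * A') b c = (\<Sum>x\<in>B. co A b x * co A' x c)"
proof -
  have "Q * (A * A') * P = (Q * A * P) * (Q * A' * P)"
  proof -
    have "(Q * A * P) * (Q * A' * P) = Q * A * ((P * Q) * A') * P"
      using P Q A A' by (simp add: assoc_mult_mat[of _ n n _ n _ n])
    also have "\<dots> = Q * (A * A') * P"
      using P Q A A' by (simp add: PQ assoc_mult_mat[of _ n n _ n _ n])
    finally show ?thesis ..
  qed
  then have "co (A * A') b c = (\<Sum>i = 0..<n. (Q * A * P) $$ (inv_into {0..<n} \<beta> b, i) *
      (Q * A' * P) $$ (i, inv_into {0..<n} \<beta> c))"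
    unfolding co_def using assms idx
    by (simp only: mat_mult_entry[OF conj_carrier conj_carrier])
  then show ?thesis
    unfolding co_def
    using sum_idx[of "\<lambda>i. (Q * A * P) $$ (inv_into {0..<n} \<beta> b, i) * (Q * A' * P) $$ (i, inv_into {0..<n} \<beta> c)"]
    by simp
qed

lemma co_add:
  assumes "A \<in> carrier_mat n n" "A' \<in> carrier_mat n n" "b \<in> B" "c \<in> B"
  shows "co (A + A') b c = co A b c + co A' b c"
proof -
  have "Q * (A + A') * P = Q * A * P + Q * A' * P"
    using assms P Q by (simp add: mult_add_distrib_mat[of _ n n] add_mult_distrib_mat[of _ n n])
  then show ?thesis using assms P Q idx[of b] idx[of c] unfolding co_def by simp
qed

lemma co_minus:
  assumes "A \<in> carrier_mat n n" "A' \<in> carrier_mat n n" "b \<in> B" "c \<in> B"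
  shows "co (A - A') b c = co A b c - co A' b c"
proof -
  have "Q * (A - A') * P = Q * A * P - Q * A' * P"
    using assms P Q by (simp add: mult_minus_distrib_mat[of _ n n] minus_mult_distrib_mat[of _ n n])
  then show ?thesis using assms P Q idx[of b] idx[of c] unfolding co_def by simp
qed

lemma co_smult:
  assumes "A \<in> carrier_mat n n" "b \<in> B" "c \<in> B"
  shows "co (x \<cdot>\<^sub>m A) b c = x * co A b c"
proof -
  have "Q * (x \<cdot>\<^sub>m A) * P = x \<cdot>\<^sub>m (Q * A * P)"
    using assms P Q by (simp add: mult_smult_distrib[of _ n n] mult_smult_assoc_mat[of _ n n])
  then show ?thesis using assms P Q idx[of b] idx[of c] unfolding co_def by simp
qed

lemma co_zero: "b \<in> B \<Longrightarrow> c \<in> B \<Longrightarrow> co (0\<^sub>m n n) b c = 0"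
  using P Q idx[of b] idx[of c] unfolding co_def by simp

lemma bas_carrier: "b \<in> B \<Longrightarrow> bas b \<in> carrier_vec n"
  using P unfolding bas_def by auto

lemma conj_bas:
  assumes A: "A \<in> carrier_mat n n" and "c \<in> B"
  shows "Q *\<^sub>v (A *\<^sub>v bas c) = col (Q * A * P) (inv_into {0..<n} \<beta> c)"
proof -
  have QA: "Q * A \<in> carrier_mat n n" using Q A by simp
  show ?thesis
    unfolding bas_def col_mult2[OF QA P idx[OF assms(2)]]
    by (rule assoc_mult_mat_vec[OF Q A col_carrier_vec[OF _ P], symmetric]) (rule idx[OF assms(2)])
qed

lemma co_eq_index: "A \<in> carrier_mat n n \<Longrightarrow> b \<in> B \<Longrightarrow> c \<in> B \<Longrightarrow>
    co A b c = (Q *\<^sub>v (A *\<^sub>v bas c)) $ inv_into {0..<n} \<beta> b"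
  using conj_bas[of A c] carrier_matD[OF conj_carrier[of A]] idx[of b] idx[of c]
  unfolding co_def by (simp del: index_mult_mat)

lemma Q_bas:
  assumes "b \<in> B" "c \<in> B"
  shows "(Q *\<^sub>v bas c) $ inv_into {0..<n} \<beta> b = (if b = c then 1 else 0)"
proof -
  have "Q *\<^sub>v bas c = col (Q * P) (inv_into {0..<n} \<beta> c)"
    unfolding bas_def by (rule col_mult2[OF Q P idx[OF assms(2)], symmetric])
  moreover have "inv_into {0..<n} \<beta> b = inv_into {0..<n} \<beta> c \<longleftrightarrow> b = c"
    using assms \<beta>_idx by metis
  ultimately show ?thesis using idx[OF assms(1)] idx[OF assms(2)] by (simp add: QP)
qed

lemma co_bas_smult:
  assumes "A \<in> carrier_mat n n" "b \<in> B" "c \<in> B" "c' \<in> B" "A *\<^sub>v bas c = x \<cdot>\<^sub>v bas c'"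
  shows "co A b c = (if b = c' then x else 0)"
  using assms Q bas_carrier[of c'] Q_bas[of b c'] idx[of b]
  by (simp add: co_eq_index mult_mat_vec[of Q n n])

lemma co_bas_zero:
  assumes "A \<in> carrier_mat n n" "b \<in> B" "c \<in> B" "A *\<^sub>v bas c = 0\<^sub>v n"
  shows "co A b c = 0"
proof -
  have "Q *\<^sub>v 0\<^sub>v n = 0\<^sub>v n" using Q by (intro eq_vecI) auto
  then show ?thesis using assms idx[of b] by (simp add: co_eq_index)
qed

lemma vec_coords_eqI:
  assumes "u \<in> carrier_vec n" "v \<in> carrier_vec n"
    and "\<And>b. b \<in> B \<Longrightarrow> (Q *\<^sub>v u) $ inv_into {0..<n} \<beta> b = (Q *\<^sub>v v) $ inv_into {0..<n} \<beta> b"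
  shows "u = v"
proof -
  have "Q *\<^sub>v u = Q *\<^sub>v v"
  proof (rule eq_vecI)
    fix i assume "i < dim_vec (Q *\<^sub>v v)"
    then have "i < n" using Q by simp
    then show "(Q *\<^sub>v u) $ i = (Q *\<^sub>v v) $ i"
      using assms(3)[of "\<beta> i"] by (simp add: \<beta>_mem idx_\<beta>)
  qed (use Q in simp)
  moreover have "P *\<^sub>v (Q *\<^sub>v x) = x" if "x \<in> carrier_vec n" for x
    using assoc_mult_mat_vec[OF P Q that] PQ that by simp
  ultimately show ?thesis using assms by metis
qed

lemma mult_bas_eqI:
  assumes A: "A \<in> carrier_mat n n" "A' \<in> carrier_mat n n" and c: "c \<in> B"
    and "\<And>b. b \<in> B \<Longrightarrow> co A b c = co A' b c"
  shows "A *\<^sub>v bas c = A' *\<^sub>v bas c"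
  using assms(4) co_eq_index[OF A(1) _ c] co_eq_index[OF A(2) _ c]
  by (intro vec_coords_eqI mult_mat_vec_carrier[OF A(1)] mult_mat_vec_carrier[OF A(2)] bas_carrier c) simp

lemma mult_bas_unitI:
  assumes A: "A \<in> carrier_mat n n" and c: "c \<in> B" "c' \<in> B"
    and "\<And>b. b \<in> B \<Longrightarrow> co A b c = (if b = c' then 1 else 0)"
  shows "A *\<^sub>v bas c = bas c'"
  using assms bas_carrier[of c] bas_carrier[of c'] Q_bas[of _ c'] co_eq_index[OF A _ c(1)]
  by (intro vec_coords_eqI mult_mat_vec_carrier[OF A]) auto

lemma mult_bas_zeroI:
  assumes A: "A \<in> carrier_mat n n" and c: "c \<in> B" and "\<And>b. b \<in> B \<Longrightarrow> co A b c = 0"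
  shows "A *\<^sub>v bas c = 0\<^sub>v n"
proof -
  have "0\<^sub>m n n *\<^sub>v bas c = 0\<^sub>v n" using bas_carrier[OF c] by (intro eq_vecI) auto
  then show ?thesis using mult_bas_eqI[OF A zero_carrier_mat c] assms by (simp add: co_zero)
qed

lemma mat_trace_mult_comm:
  fixes A A' :: "'a mat"
  assumes "A \<in> carrier_mat n n" "A' \<in> carrier_mat n n"
  shows "mat_trace (A * A') = mat_trace (A' * A)"
proof -
  have "mat_trace (A * A') = (\<Sum>i<n. \<Sum>j<n. A $$ (i, j) * A' $$ (j, i))"
    using assms by (auto simp: mat_trace_def scalar_prod_def atLeast0LessThan intro!: sum.cong)
  also have "\<dots> = (\<Sum>j<n. \<Sum>i<n. A' $$ (j, i) * A $$ (i, j))"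
    by (subst sum.swap) (intro sum.cong refl mult.commute)
  also have "\<dots> = mat_trace (A' * A)"
    using assms by (auto simp: mat_trace_def scalar_prod_def atLeast0LessThan intro!: sum.cong)
  finally show ?thesis .
qed

lemma mat_trace_co:
  assumes A: "A \<in> carrier_mat n n"
  shows "mat_trace A = (\<Sum>b\<in>B. co A b b)"
proof -
  have "mat_trace A = mat_trace ((A * P) * Q)"
    using A P Q by (simp add: PQ assoc_mult_mat[of _ n n _ n _ n])
  also have "\<dots> = mat_trace (Q * A * P)"
    using A P Q by (subst mat_trace_mult_comm) (auto simp: assoc_mult_mat[of _ n n _ n _ n])
  also have "\<dots> = (\<Sum>b\<in>B. co A b b)"
    unfolding co_def sum_idx[of "\<lambda>i. (Q * A * P) $$ (i, i)"]
    using Q by (simp add: mat_trace_def atLeast0LessThan del: index_mult_mat(1))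
  finally show ?thesis .
qed

lemma char_poly_conj:
  assumes A: "A \<in> carrier_mat n n"
  shows "char_poly A = char_poly (Q * A * P)"
proof (intro char_poly_similar similar_matI)
  show "{A, Q * A * P, P, Q} \<subseteq> carrier_mat n n" using A P Q conj_carrier by simp
  show "A = P * (Q * A * P) * Q" using P_conj_Q[OF A] by simp
qed (rule PQ QP)+

lemma char_coeff_co:
  assumes A: "A \<in> carrier_mat n n" and "l \<le> n"
    and M: "\<And>b c. b \<in> B \<Longrightarrow> c \<in> B \<Longrightarrow> co A b c = M b c"
  shows "char_coeff n l A = coeff (sdet B (\<lambda>b c. - [:0, 1:] * [:M b c:] + (if b = c then 1 else 0))) l"
proof -
  have "char_coeff n l A = char_coeff n l (Q * A * P)"
    unfolding char_coeff_def using char_poly_conj[OF A] by simp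
  also have "\<dots> = coeff (sdet B (\<lambda>b c. - [:0, 1:] * [:M b c:] + (if b = c then 1 else 0))) l"
    using co_\<beta>[of _ _ A] M \<beta>_mem by (intro char_coeff_eq[OF conj_carrier[OF A] assms(2) \<beta>]) metis
  finally show ?thesis .
qed

end

section \<open>The Slodowy slice in Jordan coordinates\<close>

text \<open>The given data in labelled coordinates. The vectors \<open>w\<close> and the eigenvalues
  fix the matrices of \<open>e\<close> and \<open>h\<close>; that of \<open>f\<close> is derived
  from the triple in \<open>co_f\<close>.\<close>

locale jordan_slice = jordan_type k d + mat_coords n "jordan_type.B k d" \<beta> P Q
  for k d n \<beta> and P Q :: "'a::field_char_0 mat" +
  fixes e h f :: "'a mat" and w :: "nat \<Rightarrow> 'a vec"
  assumes bas_eq: "\<And>i s. (i, s) \<in> B \<Longrightarrow> bas (i, s) = (e ^\<^sub>m s) *\<^sub>v w i"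
    and w: "\<And>i. i \<in> {1..k} \<Longrightarrow> w i \<in> carrier_vec n"
    and top: "\<And>i. i \<in> {1..k} \<Longrightarrow> (e ^\<^sub>m (d i + 1)) *\<^sub>v w i = 0\<^sub>v n"
    and triple: "sl2_triple n e h f"
    and hw: "\<And>i s. (i, s) \<in> B \<Longrightarrow> h *\<^sub>v bas (i, s) = (2 * of_nat s - of_nat (d i)) \<cdot>\<^sub>v bas (i, s)"
begin

lemma e: "e \<in> carrier_mat n n" and h: "h \<in> carrier_mat n n" and f: "f \<in> carrier_mat n n"
  using triple by (auto simp: sl2_triple_def)

lemma mem_B: "(i, a) \<in> B \<longleftrightarrow> i \<in> {1..k} \<and> a \<le> d i"
  by (auto simp: B_def)

lemma pow_carrier: "e ^\<^sub>m s \<in> carrier_mat n n"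
  using e by simp

lemma pow_comm:
  assumes "x \<in> carrier_mat n n" "e * x = x * e"
  shows "(e ^\<^sub>m s) * x = x * (e ^\<^sub>m s)"
proof (induction s)
  case 0
  then show ?case using assms e by simp
next
  case (Suc s)
  have "(e ^\<^sub>m Suc s) * x = (e ^\<^sub>m s) * (e * x)"
    using e assms by (simp add: assoc_mult_mat[OF pow_carrier e assms(1)])
  also have "\<dots> = ((e ^\<^sub>m s) * x) * e"
    by (simp add: assms(2) assoc_mult_mat[OF pow_carrier assms(1) e])
  also have "\<dots> = x * (e ^\<^sub>m Suc s)"
    by (simp add: Suc assoc_mult_mat[OF assms(1) pow_carrier e])
  finally show ?case .
qed

lemma w_bas: "i \<in> {1..k} \<Longrightarrow> w i = bas (i, 0)"
  using bas_eq[of i 0] w[of i] e by (simp add: mem_B)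

lemma e_bas:
  assumes "(i, s) \<in> B"
  shows "e *\<^sub>v bas (i, s) = (e ^\<^sub>m Suc s) *\<^sub>v w i"
proof -
  have i: "i \<in> {1..k}" using assms by (simp add: mem_B)
  have "e *\<^sub>v bas (i, s) = (e * (e ^\<^sub>m s)) *\<^sub>v w i"
    unfolding bas_eq[OF assms] using assoc_mult_mat_vec[OF e pow_carrier w[OF i]] by simp
  also have "e * (e ^\<^sub>m s) = e ^\<^sub>m Suc s" using pow_comm[OF e refl] by simp
  finally show ?thesis .
qed

lemma co_e:
  assumes b: "b \<in> B" and c: "c \<in> B"
  shows "co e b c = shift b c"
proof -
  obtain j t where c': "c = (j, t)" by fastforce
  have j: "j \<in> {1..k}" "t \<le> d j" using c by (auto simp: c' mem_B)
  show ?thesis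
  proof (cases "t < d j")
    case True
    then have m: "(j, Suc t) \<in> B" using j by (simp add: mem_B)
    have "e *\<^sub>v bas c = 1 \<cdot>\<^sub>v bas (j, Suc t)"
      using e_bas[of j t] c bas_eq[OF m] by (simp add: c')
    then have "co e b c = (if b = (j, Suc t) then 1 else 0)"
      by (rule co_bas_smult[OF e b c m])
    then show ?thesis by (cases b) (auto simp: shift_def c')
  next
    case False
    then have "t = d j" using j by simp
    then have "e *\<^sub>v bas c = 0\<^sub>v n" using e_bas[of j t] c top[OF j(1)] by (simp add: c')
    then have "co e b c = 0" by (rule co_bas_zero[OF e b c])
    then show ?thesis using b False by (cases b) (auto simp: shift_def c' mem_B)
  qed
qed

section \<open>Weights and the matrix of f\<close>

definition wt :: "nat \<times> nat \<Rightarrow> 'a" where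
  "wt b = 2 * of_nat (snd b) - of_nat (d (fst b))"

lemma co_h:
  assumes b: "b \<in> B" and c: "c \<in> B"
  shows "co h b c = (if b = c then wt c else 0)"
proof -
  have "h *\<^sub>v bas c = wt c \<cdot>\<^sub>v bas c" using hw[of "fst c" "snd c"] c by (simp add: wt_def)
  then show ?thesis by (rule co_bas_smult[OF h b c c])
qed

lemma sum_shift_left:
  assumes "(i, a) \<in> B"
  shows "(\<Sum>x\<in>B. shift (i, a) x * g x) = (if a > 0 then g (i, a - 1) else (0 :: 'a))"
proof -
  have "(\<Sum>x\<in>B. shift (i, a) x * g x) = (\<Sum>x\<in>B. if x = (i, a - 1) then if a > 0 then g (i, a - 1) else 0 else 0)"
    by (intro sum.cong) (auto simp: shift_def)
  then show ?thesis using assms by (simp add: finite_B) (auto simp: mem_B)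
qed

lemma sum_shift_right:
  assumes "(j, t) \<in> B"
  shows "(\<Sum>x\<in>B. g x * shift x (j, t)) = (if t < d j then g (j, t + 1) else (0 :: 'a))"
proof -
  have "(\<Sum>x\<in>B. g x * shift x (j, t)) = (\<Sum>x\<in>B. if x = (j, t + 1) then g (j, t + 1) else 0)"
    by (intro sum.cong) (auto simp: shift_def)
  then show ?thesis using assms by (simp add: finite_B mem_B)
qed

lemma co_commutator_h:
  assumes "x \<in> carrier_mat n n" "b \<in> B" "c \<in> B"
  shows "co (commutator h x) b c = (wt b - wt c) * co x b c"
proof -
  have "co (commutator h x) b c = (\<Sum>y\<in>B. co h b y * co x y c) - (\<Sum>y\<in>B. co x b y * co h y c)"
    unfolding commutator_def using assms h by (subst co_minus) (simp_all add: co_mult)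
  also have "(\<Sum>y\<in>B. co h b y * co x y c) = (\<Sum>y\<in>B. if y = b then wt b * co x b c else 0)"
    using assms by (intro sum.cong) (auto simp: co_h)
  also have "(\<Sum>y\<in>B. co x b y * co h y c) = (\<Sum>y\<in>B. if y = c then wt c * co x b c else 0)"
    using assms by (intro sum.cong) (auto simp: co_h)
  finally show ?thesis using assms by (simp add: finite_B algebra_simps)
qed

text \<open>Characteristic zero turns an equation between weights into one between integers, where
  heights can be compared.\<close>

lemma wt_relation:
  assumes "wt (i, a) - wt (j, b) + 2 = 0"
  shows "2 * int a - int (d i) - (2 * int b - int (d j)) + 2 = 0"
proof -
  have "of_int (2 * int a - int (d i) - (2 * int b - int (d j)) + 2) = (0 :: 'a)"
    using assms by (simp add: wt_def)
  then show ?thesis by (simp only: of_int_eq_0_iff)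
qed

text \<open>The classical coefficient of the irreducible representation of dimension
  \<open>d i + 1\<close>: \<open>f\<close> sends \<open>e^a w_i\<close> to
  \<open>a (d i + 1 - a) e^(a - 1) w_i\<close>.\<close>

definition f_coeff :: "nat \<Rightarrow> nat \<Rightarrow> nat" where
  "f_coeff i a = a * (d i + 1 - a)"

lemma f_coeff_pos: "1 \<le> a \<Longrightarrow> a \<le> d i \<Longrightarrow> 0 < f_coeff i a"
  by (simp add: f_coeff_def)

text \<open>
  \<open>G\<close> is the difference of two candidates for \<open>f\<close>: it has weight \<open>- 2\<close> and commutes with \<open>e\<close>, so
  it moves along diagonals of each block until the weight forces it to vanish.
\<close>

lemma uniqueness_f:
  assumes G: "\<And>b c. b \<in> B \<Longrightarrow> c \<in> B \<Longrightarrow> (wt b - wt c + 2) * G b c = 0"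
    and R: "\<And>i a j t. (i, a) \<in> B \<Longrightarrow> (j, t) \<in> B \<Longrightarrow>
      (if a > 0 then G (i, a - 1) (j, t) else 0) = (if t < d j then G (i, a) (j, t + 1) else 0)"
    and ij: "(i, a) \<in> B" "(j, b) \<in> B"
  shows "G (i, a) (j, b) = 0"
\<comment> \<open>The weight ties \<open>a\<close> to \<open>b\<close>. If
  \<open>d j \<le> d i\<close>, it keeps \<open>a\<close> below \<open>d i\<close>, so the diagonal
  can be followed upwards until \<open>b\<close> reaches the end of its block; otherwise it keeps
  \<open>a\<close> below \<open>b\<close>, and the diagonal is followed downwards until
  \<open>a\<close> is 0.\<close>
proof (cases "d j \<le> d i")
  case True
  from ij show ?thesis
  proof (induction "d j - b" arbitrary: a b rule: less_induct)
    case less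
    show ?case
    proof (rule ccontr)
      assume n: "G (i, a) (j, b) \<noteq> 0"
      then have "wt (i, a) - wt (j, b) + 2 = 0" using G[OF less.prems] by simp
      from wt_relation[OF this] have a: "a < d i" using True less.prems by (auto simp: mem_B)
      then have "G (i, a) (j, b) = (if b < d j then G (i, a + 1) (j, b + 1) else 0)"
        using R[of i "a + 1" j b] less.prems by (simp add: mem_B)
      then show False using n a less.prems less.hyps[of "b + 1" "a + 1"]
        by (auto simp: mem_B split: if_splits)
    qed
  qed
next
  case False
  from ij show ?thesis
  proof (induction a arbitrary: b rule: less_induct)
    case (less a)
    show ?case
    proof (rule ccontr)
      assume n: "G (i, a) (j, b) \<noteq> 0"
      then have "wt (i, a) - wt (j, b) + 2 = 0" using G[OF less.prems] by simp
      from wt_relation[OF this] have b: "a < b" using False less.prems by (auto simp: mem_B)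
      then have "G (i, a) (j, b) = (if a > 0 then G (i, a - 1) (j, b - 1) else 0)"
        using R[of i a j "b - 1"] less.prems by (cases b) (simp_all add: mem_B)
      then show False using n b less.prems less.IH[of "a - 1" "b - 1"]
        by (auto simp: mem_B split: if_splits)
    qed
  qed
qed

text \<open>The classical matrix \<open>?F0\<close> satisfies the same relations with
  \<open>h\<close> and \<open>e\<close> as \<open>f\<close>. Hence the difference has weight
  \<open>- 2\<close> and commutes with \<open>e\<close>, and \<open>uniqueness_f\<close> makes it
  vanish.\<close>

lemma co_f:
  assumes ij: "(i, a) \<in> B" "(j, b) \<in> B"
  shows "co f (i, a) (j, b) = (if i = j \<and> b = a + 1 then of_nat (f_coeff j b) else 0)"
proof -
  let ?F0 = "\<lambda>x y. if fst x = fst y \<and> snd y = snd x + 1 then of_nat (f_coeff (fst y) (snd y)) else (0 :: 'a)"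
  let ?G = "\<lambda>x y. co f x y - ?F0 x y"
  have t: "commutator h f = (- 2) \<cdot>\<^sub>m f" "commutator e f = h" using triple by (auto simp: sl2_triple_def)
  have "?G (i, a) (j, b) = 0"
  proof (rule uniqueness_f[where G = ?G])
    fix b c assume bc: "b \<in> B" "c \<in> B"
    have "(wt b - wt c) * co f b c = - 2 * co f b c"
      using co_commutator_h[OF f bc] bc f by (simp add: t co_smult)
    then have "(wt b - wt c + 2) * co f b c = 0" by (simp add: algebra_simps)
    moreover have "(wt b - wt c + 2) * ?F0 b c = 0" by (auto simp: wt_def)
    ultimately show "(wt b - wt c + 2) * ?G b c = 0"
      by (simp only: right_diff_distrib diff_zero)
  next
    fix i a j t assume ia: "(i, a) \<in> B" "(j, t) \<in> B"
    have "co h (i, a) (j, t) = (\<Sum>x\<in>B. co e (i, a) x * co f x (j, t)) - (\<Sum>x\<in>B. co f (i, a) x * co e x (j, t))"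
      unfolding t(2)[symmetric] commutator_def using ia e f by (subst co_minus) (simp_all add: co_mult)
    also have "(\<Sum>x\<in>B. co e (i, a) x * co f x (j, t)) = (\<Sum>x\<in>B. shift (i, a) x * co f x (j, t))"
      using ia by (intro sum.cong) (auto simp: co_e)
    also have "(\<Sum>x\<in>B. co f (i, a) x * co e x (j, t)) = (\<Sum>x\<in>B. co f (i, a) x * shift x (j, t))"
      using ia by (intro sum.cong) (auto simp: co_e)
    finally have c: "(if a > 0 then co f (i, a - 1) (j, t) else 0) - (if t < d j then co f (i, a) (j, t + 1) else 0) =
        (if (i, a) = (j, t) then wt (j, t) else 0)"
      using ia by (simp add: co_h sum_shift_left sum_shift_right)
    have "(if a > 0 then ?F0 (i, a - 1) (j, t) else 0) - (if t < d j then ?F0 (i, a) (j, t + 1) else 0) =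
        (if (i, a) = (j, t) then wt (j, t) else 0)"
    proof (cases "(i, a) = (j, t)")
      case True
      have "t \<le> d j" using ia by (simp add: mem_B)
      \<comment> \<open>Removes the truncated subtraction in \<open>f_coeff\<close>, leaving the
        ring identity \<open>t (r + 1) - (t + 1) r = t - r\<close>.\<close>
      then obtain r where "d j = t + r" using le_Suc_ex by blast
      then show ?thesis using ia True
        by (auto simp: f_coeff_def wt_def mem_B algebra_simps)
    next
      case False
      then show ?thesis by auto
    qed
    with c have "(if a > 0 then co f (i, a - 1) (j, t) else 0) - (if a > 0 then ?F0 (i, a - 1) (j, t) else 0) =
        (if t < d j then co f (i, a) (j, t + 1) else 0) - (if t < d j then ?F0 (i, a) (j, t + 1) else 0)"
      by (simp only: diff_eq_eq) (simp only: algebra_simps)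
    then show "(if a > 0 then ?G (i, a - 1) (j, t) else 0) = (if t < d j then ?G (i, a) (j, t + 1) else 0)"
      by (cases "a > 0"; cases "t < d j") (simp_all only: if_True if_False diff_self)
  qed (rule ij)+
  then show ?thesis by simp
qed

lemma sum_co_f_left:
  assumes "(i, a) \<in> B"
  shows "(\<Sum>x\<in>B. co f (i, a) x * g x) = (if a < d i then of_nat (f_coeff i (a + 1)) * g (i, a + 1) else 0)"
proof -
  have "(\<Sum>x\<in>B. co f (i, a) x * g x) = (\<Sum>x\<in>B. if x = (i, a + 1) then of_nat (f_coeff i (a + 1)) * g (i, a + 1) else 0)"
    using assms by (intro sum.cong) (auto simp: co_f split: if_splits)
  then show ?thesis using assms by (simp add: finite_B mem_B)
qed

lemma sum_co_f_right:
  assumes "(j, b) \<in> B"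
  shows "(\<Sum>x\<in>B. g x * co f x (j, b)) = (if b > 0 then g (j, b - 1) * of_nat (f_coeff j b) else 0)"
proof -
  have "(\<Sum>x\<in>B. g x * co f x (j, b)) = (\<Sum>x\<in>B. if x = (j, b - 1) then if b > 0 then g (j, b - 1) * of_nat (f_coeff j b) else 0 else 0)"
    using assms by (intro sum.cong) (auto simp: co_f split: if_splits)
  then show ?thesis using assms by (simp add: finite_B) (auto simp: mem_B)
qed

section \<open>The centraliser of f\<close>

lemma centraliser_f_iff:
  "y \<in> centraliser n f \<longleftrightarrow> y \<in> carrier_mat n n \<and> (\<forall>i a j b. (i, a) \<in> B \<longrightarrow> (j, b) \<in> B \<longrightarrow>
    (if a < d i then of_nat (f_coeff i (a + 1)) * co y (i, a + 1) (j, b) else 0) =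
    (if b > 0 then co y (i, a) (j, b - 1) * of_nat (f_coeff j b) else 0))"
proof -
  have *: "f * y = y * f \<longleftrightarrow> (\<forall>i a j b. (i, a) \<in> B \<longrightarrow> (j, b) \<in> B \<longrightarrow>
    (if a < d i then of_nat (f_coeff i (a + 1)) * co y (i, a + 1) (j, b) else 0) =
    (if b > 0 then co y (i, a) (j, b - 1) * of_nat (f_coeff j b) else 0))" (is "_ = ?r")
    if y: "y \<in> carrier_mat n n"
  proof -
    have "f * y = y * f \<longleftrightarrow> (\<forall>b\<in>B. \<forall>c\<in>B. co (f * y) b c = co (y * f) b c)"
      using f y by (metis co_eqI mult_carrier_mat)
    also have "\<dots> \<longleftrightarrow> (\<forall>i a j b. (i, a) \<in> B \<longrightarrow> (j, b) \<in> B \<longrightarrow> co (f * y) (i, a) (j, b) = co (y * f) (i, a) (j, b))"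
      by auto
    also have "\<dots> \<longleftrightarrow> ?r"
      using f y by (simp add: co_mult sum_co_f_left sum_co_f_right cong: imp_cong)
    finally show ?thesis .
  qed
  show ?thesis
    unfolding centraliser_def mem_Collect_eq by (rule conj_cong[OF refl *])
qed

lemma co_centraliser_f:
  assumes "y \<in> centraliser n f" "(i, a) \<in> B" "(j, b) \<in> B"
  shows "(if a < d i then of_nat (f_coeff i (a + 1)) * co y (i, a + 1) (j, b) else 0) =
    (if b > 0 then co y (i, a) (j, b - 1) * of_nat (f_coeff j b) else 0)"
  using assms(1)[unfolded centraliser_f_iff] assms(2,3) by blast

text \<open>In column height 0 the relation with \<open>f\<close> leaves a positive coefficient
  times the entry equal to 0; the vanishing then spreads up the diagonal.\<close>

lemma co_centraliser_f_below:
  assumes y: "y \<in> centraliser n f" and "(i, a) \<in> B" "(j, b) \<in> B" "b < a"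
  shows "co y (i, a) (j, b) = 0"
  using assms(2-)
proof (induction b arbitrary: a)
  case 0
  then show ?case using co_centraliser_f[OF y, of i "a - 1" j 0] f_coeff_pos[of a i]
    by (cases a) (auto simp: mem_B split: if_splits)
next
  case (Suc b)
  then have "co y (i, a - 1) (j, b) = 0" by (intro Suc.IH) (auto simp: mem_B)
  then show ?case
    using co_centraliser_f[OF y, of i "a - 1" j "Suc b"] f_coeff_pos[of a i] Suc.prems
    by (cases a) (auto simp: mem_B split: if_splits)
qed

text \<open>The mirror image: vanishing starts in the top row \<open>a = d i\<close>, where
  \<open>f * y\<close> contributes nothing, and spreads down the diagonal.\<close>

lemma co_centraliser_f_above:
  assumes y: "y \<in> centraliser n f" and "(i, a) \<in> B" "(j, b) \<in> B" "b + d i < d j + a"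
  shows "co y (i, a) (j, b) = 0"
  using assms(2-)
proof (induction "d i - a" arbitrary: a b)
  case 0
  then show ?case using co_centraliser_f[OF y, of i a j "b + 1"] f_coeff_pos[of "b + 1" j]
    by (auto simp: mem_B split: if_splits)
next
  case (Suc r)
  then have "co y (i, a + 1) (j, b + 1) = 0" by (intro Suc.hyps(1)) (auto simp: mem_B)
  then show ?case
    using co_centraliser_f[OF y, of i a j "b + 1"] f_coeff_pos[of "b + 1" j] Suc.prems
    by (auto simp: mem_B split: if_splits)
qed

text \<open>The diagonals that carry \<open>y\<close> are the ones that index the basis vectors
  \<open>\<xi>\<close>; this is the hypothesis on \<open>Y\<close> in
  \<open>deg_part_eq_diag_sums\<close>.\<close>

lemma co_centraliser_f_range:
  assumes y: "y \<in> centraliser n f" and "(i, a) \<in> B" "(j, b) \<in> B" "co y (i, a) (j, b) \<noteq> 0"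
  shows "a \<le> b \<and> b - a \<in> xi_range d i j"
  using co_centraliser_f_below[OF assms(1-3)] co_centraliser_f_above[OF assms(1-3)] assms(3,4)
  by (force simp: xi_range_def mem_B)

text \<open>The quotient of the entry at height \<open>a\<close> by the one at height 0 on a
  diagonal of an element commuting with \<open>f\<close>. It is kept rational because positivity
  makes sense there, whereas the ground field has no order.\<close>

definition diag_ratio :: "nat \<Rightarrow> nat \<Rightarrow> nat \<Rightarrow> nat \<Rightarrow> rat" where
  "diag_ratio i j s a = (\<Prod>q=1..a. of_nat (f_coeff j (s + q)) / of_nat (f_coeff i q))"

lemma diag_ratio_pos:
  assumes "a \<le> d i" "a + s \<le> d j"
  shows "0 < diag_ratio i j s a"
  unfolding diag_ratio_def using assms f_coeff_pos by (intro prod_pos) auto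

lemma diag_ratio_Suc:
  assumes "a < d i"
  shows "of_nat (f_coeff i (a + 1)) * of_rat (diag_ratio i j s (a + 1)) =
    (of_rat (diag_ratio i j s a) * of_nat (f_coeff j (a + s + 1)) :: 'a)"
proof -
  have "of_nat (f_coeff i (a + 1)) * diag_ratio i j s (a + 1) = diag_ratio i j s a * of_nat (f_coeff j (a + s + 1))"
    using f_coeff_pos[of "a + 1" i] assms by (simp add: diag_ratio_def add_ac)
  then have "of_rat (of_nat (f_coeff i (a + 1)) * diag_ratio i j s (a + 1)) =
      (of_rat (diag_ratio i j s a * of_nat (f_coeff j (a + s + 1))) :: 'a)" by simp
  then show ?thesis by (simp only: of_rat_mult of_rat_of_nat_eq)
qed

lemma co_centraliser_f_diag:
  assumes y: "y \<in> centraliser n f" and "(i, a) \<in> B" "(j, a + s) \<in> B"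
  shows "co y (i, a) (j, a + s) = of_rat (diag_ratio i j s a) * co y (i, 0) (j, s)"
  using assms(2-)
proof (induction a)
  case 0
  then show ?case by (simp add: diag_ratio_def)
next
  case (Suc a)
  have IH: "co y (i, a) (j, a + s) = of_rat (diag_ratio i j s a) * co y (i, 0) (j, s)"
    using Suc.prems by (intro Suc.IH) (auto simp: mem_B)
  have a: "a < d i" using Suc.prems by (simp add: mem_B)
  have "of_nat (f_coeff i (a + 1)) * co y (i, a + 1) (j, a + s + 1) = co y (i, a) (j, a + s) * of_nat (f_coeff j (a + s + 1))"
    using co_centraliser_f[OF y, of i a j "a + s + 1"] Suc.prems by (auto simp: mem_B)
  also have "\<dots> = of_nat (f_coeff i (a + 1)) * (of_rat (diag_ratio i j s (a + 1)) * co y (i, 0) (j, s))"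
    unfolding IH using diag_ratio_Suc[OF a, of j s] by (simp add: mult_ac)
  finally show ?case using f_coeff_pos[of "a + 1" i] a by simp
qed

definition diag_total :: "nat \<Rightarrow> nat \<Rightarrow> nat \<Rightarrow> rat" where
  "diag_total i j s = (\<Sum>a | a \<le> d i \<and> a + s \<le> d j. diag_ratio i j s a)"

text \<open>A nonempty sum of positive rationals. Its image in a field of characteristic zero is
  therefore nonzero, although cancellation in the field could not be excluded directly.\<close>

lemma diag_total_pos:
  assumes "s \<le> d j"
  shows "0 < diag_total i j s"
  unfolding diag_total_def using assms diag_ratio_pos
  by (intro sum_pos) (auto intro: exI[of _ 0])

lemma diag_sum_centraliser_f:
  assumes y: "y \<in> centraliser n f" and ij: "i \<in> {1..k}" "j \<in> {1..k}"
  shows "diag_sum (co y) i j s = of_rat (diag_total i j s) * co y (i, 0) (j, s)"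
proof -
  have "diag_sum (co y) i j s = (\<Sum>a | a \<le> d i \<and> a + s \<le> d j. of_rat (diag_ratio i j s a) * co y (i, 0) (j, s))"
    unfolding diag_sum_def using ij by (intro sum.cong refl co_centraliser_f_diag[OF y]) (auto simp: mem_B)
  then show ?thesis by (simp add: diag_total_def of_rat_sum sum_distrib_right)
qed

section \<open>The basis of the centraliser of e and the trace form\<close>

definition xi_co :: "nat \<Rightarrow> nat \<Rightarrow> nat \<Rightarrow> nat \<times> nat \<Rightarrow> nat \<times> nat \<Rightarrow> 'a" where
  "xi_co i j s b c = (if fst c = i \<and> fst b = j \<and> snd b = snd c + s then 1 else 0)"

text \<open>The vectors \<open>w t\<close> generate the space under powers of \<open>e\<close>, with
  which \<open>x\<close> commutes. This gives the uniqueness behind \<open>THE\<close> in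
  \<open>xi\<close>.\<close>

lemma centraliser_e_unique:
  assumes x: "x \<in> centraliser n e" "x' \<in> centraliser n e"
    and eq: "\<And>t. t \<in> {1..k} \<Longrightarrow> x *\<^sub>v w t = x' *\<^sub>v w t"
  shows "x = x'"
proof (rule co_eqI)
  show x': "x \<in> carrier_mat n n" "x' \<in> carrier_mat n n" using x by (auto simp: centraliser_def)
  fix b c assume b: "b \<in> B" and c: "c \<in> B"
  obtain j t where jt: "c = (j, t)" by fastforce
  have j: "j \<in> {1..k}" using c by (auto simp: jt mem_B)
  have "z *\<^sub>v bas c = (e ^\<^sub>m t) *\<^sub>v (z *\<^sub>v w j)" if z: "z \<in> centraliser n e" for z
  proof -
    have zc: "z \<in> carrier_mat n n" and "e * z = z * e" using z by (auto simp: centraliser_def)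
    then have "(e ^\<^sub>m t) * z = z * (e ^\<^sub>m t)" by (rule pow_comm)
    then show ?thesis
      using c assoc_mult_mat_vec[OF zc pow_carrier w[OF j]] assoc_mult_mat_vec[OF pow_carrier zc w[OF j]]
      by (metis bas_eq jt)
  qed
  then have "x *\<^sub>v bas c = x' *\<^sub>v bas c" using x eq[OF j] by simp
  then show "co x b c = co x' b c" using co_eq_index[OF _ b c] x' by simp
qed

text \<open>The lower bound of \<open>xi_range\<close> matters at the top of block \<open>i\<close>:
  the vector \<open>e^(d i) w_i\<close> must go to a vector killed by \<open>e\<close>, which
  amounts to \<open>d j \<le> d i + s\<close>.\<close>

lemma of_xi_co_centraliser:
  assumes "s \<in> xi_range d i j"
  shows "of_co (xi_co i j s) \<in> centraliser n e"
proof -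
  let ?x = "of_co (xi_co i j s)"
  have "e * ?x = ?x * e"
  proof (rule co_eqI)
    fix b c assume b: "b \<in> B" and c: "c \<in> B"
    obtain p a q t where bc: "b = (p, a)" "c = (q, t)" by fastforce
    have "co (e * ?x) b c = (\<Sum>x\<in>B. shift b x * xi_co i j s x c)"
      unfolding co_mult[OF e of_co_carrier b c]
      using b c by (intro sum.cong) (auto simp: co_e co_of_co)
    also have "\<dots> = (\<Sum>x\<in>B. xi_co i j s b x * shift x c)"
      using assms b c unfolding bc
      by (simp add: sum_shift_left sum_shift_right) (auto simp: xi_co_def xi_range_def mem_B)
    also have "\<dots> = co (?x * e) b c"
      unfolding co_mult[OF of_co_carrier e b c]
      using b c by (intro sum.cong) (auto simp: co_e co_of_co)
    finally show "co (e * ?x) b c = co (?x * e) b c" .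
  qed (rule mult_carrier_mat[OF e of_co_carrier] mult_carrier_mat[OF of_co_carrier e])+
  then show ?thesis using of_co_carrier by (simp add: centraliser_def)
qed

lemma xi_eq_of_co:
  assumes ij: "i \<in> {1..k}" "j \<in> {1..k}" and s: "s \<in> xi_range d i j"
  shows "xi n e k d w i j s = of_co (xi_co i j s)"
proof -
  let ?x = "of_co (xi_co i j s)"
  have sj: "(j, s) \<in> B" using s ij by (auto simp: xi_range_def mem_B)
  have x: "?x *\<^sub>v w t = (if t = i then (e ^\<^sub>m s) *\<^sub>v w j else 0\<^sub>v n)" if t: "t \<in> {1..k}" for t
  proof (cases "t = i")
    case True
    have "?x *\<^sub>v bas (t, 0) = bas (j, s)"
      using t True sj by (intro mult_bas_unitI of_co_carrier) (auto simp: co_of_co xi_co_def mem_B prod_eq_iff)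
    then show ?thesis using True t sj by (simp add: w_bas bas_eq)
  next
    case False
    have "?x *\<^sub>v bas (t, 0) = 0\<^sub>v n"
      using t False by (intro mult_bas_zeroI of_co_carrier) (auto simp: co_of_co xi_co_def mem_B)
    then show ?thesis using False t by (simp add: w_bas)
  qed
  have "(THE x. x \<in> centraliser n e \<and>
      (\<forall>t\<in>{1..k}. x *\<^sub>v w t = (if t = i then (e ^\<^sub>m s) *\<^sub>v w j else 0\<^sub>v n))) = ?x"
  proof (rule the_equality)
    show "?x \<in> centraliser n e \<and> (\<forall>t\<in>{1..k}. ?x *\<^sub>v w t = (if t = i then (e ^\<^sub>m s) *\<^sub>v w j else 0\<^sub>v n))"
      using of_xi_co_centraliser[OF s] x by blast
  next
    fix x' assume "x' \<in> centraliser n e \<and> (\<forall>t\<in>{1..k}. x' *\<^sub>v w t = (if t = i then (e ^\<^sub>m s) *\<^sub>v w j else 0\<^sub>v n))"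
    then show "x' = ?x" using x by (intro centraliser_e_unique of_xi_co_centraliser[OF s]) simp_all
  qed
  then show ?thesis using s by (simp only: xi_def if_True)
qed

lemma mat_trace_xi:
  assumes ij: "i \<in> {1..k}" "j \<in> {1..k}" and s: "s \<in> xi_range d i j" and y: "y \<in> carrier_mat n n"
  shows "mat_trace (xi n e k d w i j s * y) = diag_sum (co y) i j s"
proof -
  have "mat_trace (xi n e k d w i j s * y) = (\<Sum>b\<in>B. \<Sum>c\<in>B. xi_co i j s b c * co y c b)"
    unfolding xi_eq_of_co[OF ij s] mat_trace_co[OF mult_carrier_mat[OF of_co_carrier y]]
    by (intro sum.cong refl) (simp add: co_mult[OF of_co_carrier y] co_of_co)
  also have "\<dots> = (\<Sum>(b, c)\<in>B \<times> B. xi_co i j s b c * co y c b)"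
    by (simp add: sum.cartesian_product)
  also have "\<dots> = (\<Sum>(b, c)\<in>(\<lambda>a. ((j, a + s), (i, a))) ` {a. a \<le> d i \<and> a + s \<le> d j}. xi_co i j s b c * co y c b)"
    using ij by (intro sum.mono_neutral_right) (auto simp: finite_B mem_B xi_co_def image_iff)
  also have "\<dots> = diag_sum (co y) i j s"
    unfolding diag_sum_def by (subst sum.reindex) (auto simp: inj_on_def xi_co_def)
  finally show ?thesis .
qed

lemma ad_eigenvalue_xi:
  assumes ij: "i \<in> {1..k}" "j \<in> {1..k}" and s: "s \<in> xi_range d i j"
  shows "ad_eigenvalue h (xi n e k d w i j s) = 2 * of_nat s - of_nat (d j) + of_nat (d i)"
proof -
  let ?x = "of_co (xi_co i j s)" and ?r = "2 * of_nat s - of_nat (d j) + of_nat (d i) :: 'a"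
  have c: "co (commutator h ?x) b c = ?r * co ?x b c" if "b \<in> B" "c \<in> B" for b c
    using that co_commutator_h[OF of_co_carrier that] by (auto simp: co_of_co xi_co_def wt_def)
  have "commutator h ?x \<in> carrier_mat n n"
    unfolding commutator_def by (intro minus_carrier_mat mult_carrier_mat[OF of_co_carrier h])
  then have 1: "commutator h ?x = ?r \<cdot>\<^sub>m ?x"
    by (rule co_eqI) (simp_all add: of_co_carrier c co_smult[OF of_co_carrier])
  have B: "(j, s) \<in> B" "(i, 0) \<in> B" using s ij by (auto simp: xi_range_def mem_B)
  \<comment> \<open>The entry in row \<open>(j, s)\<close> and column \<open>(i, 0)\<close> is 1, so
    the matrix is nonzero and determines its eigenvalue.\<close>
  have "a = ?r" if "commutator h ?x = a \<cdot>\<^sub>m ?x" for a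
  proof -
    have "co (a \<cdot>\<^sub>m ?x) (j, s) (i, 0) = co (?r \<cdot>\<^sub>m ?x) (j, s) (i, 0)" using 1 that by simp
    then show ?thesis using B by (simp add: co_smult[OF of_co_carrier] co_of_co xi_co_def)
  qed
  with 1 show ?thesis unfolding ad_eigenvalue_def xi_eq_of_co[OF ij s] by (intro the_equality) auto
qed

text \<open>The duality given by the trace form, made explicit: each matrix entry, as a function on
  the centraliser of \<open>f\<close>, is the linear function of an element of the centraliser of
  \<open>e\<close>.\<close>

lemma co_eq_mat_trace:
  assumes "b \<in> B" "c \<in> B"
  shows "\<exists>x\<in>centraliser n e. \<forall>y\<in>centraliser n f. co y b c = mat_trace (x * y)"
proof -
  obtain i a j t where bc: "b = (i, a)" "c = (j, t)" by fastforce
  have ij: "i \<in> {1..k}" "j \<in> {1..k}" and t: "t \<le> d j" using assms by (auto simp: bc mem_B)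
  show ?thesis
  proof (cases "a \<le> t \<and> t - a \<in> xi_range d i j")
    case True
    then have s: "t - a \<in> xi_range d i j" and at: "t = a + (t - a)" by auto
    \<comment> \<open>The trace against \<open>\<xi>\<close> is \<open>diag_total\<close> times the
      bottom entry of the diagonal, while the wanted entry is \<open>diag_ratio\<close> times it;
      their quotient is the scaling factor.\<close>
    let ?r = "of_rat (diag_ratio i j (t - a) a / diag_total i j (t - a)) :: 'a"
    let ?x = "?r \<cdot>\<^sub>m xi n e k d w i j (t - a)"
    have xc: "xi n e k d w i j (t - a) \<in> centraliser n e"
      unfolding xi_eq_of_co[OF ij s] by (rule of_xi_co_centraliser[OF s])
    then have "?x \<in> centraliser n e"
      using e by (auto simp: centraliser_def mult_smult_distrib[of _ n n] mult_smult_assoc_mat[of _ n n])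
    moreover have "co y b c = mat_trace (?x * y)" if y: "y \<in> centraliser n f" for y
    proof -
      have yc: "y \<in> carrier_mat n n" using y by (simp add: centraliser_def)
      have tot: "0 < diag_total i j (t - a)" using t by (intro diag_total_pos) auto
      have "mat_trace (?x * y) = ?r * mat_trace (xi n e k d w i j (t - a) * y)"
        using xc yc by (auto simp: centraliser_def mult_smult_assoc_mat[of _ n n] mat_trace_def sum_distrib_left intro!: sum.cong)
      also have "\<dots> = of_rat (diag_ratio i j (t - a) a / diag_total i j (t - a) * diag_total i j (t - a)) * co y (i, 0) (j, t - a)"
        unfolding mat_trace_xi[OF ij s yc] diag_sum_centraliser_f[OF y ij]
        by (simp only: of_rat_mult mult.assoc)
      also have "\<dots> = of_rat (diag_ratio i j (t - a) a) * co y (i, 0) (j, t - a)" using tot by simp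
      also have "\<dots> = co y b c"
        using co_centraliser_f_diag[OF y, of i a j "t - a"] assms at by (simp add: bc)
      finally show ?thesis ..
    qed
    ultimately show ?thesis by blast
  next
    case False
    then have "co y b c = 0" if "y \<in> centraliser n f" for y
      using co_centraliser_f_range[OF that] assms by (auto simp: bc)
    moreover have "mat_trace (0\<^sub>m n n * y) = 0" if "y \<in> centraliser n f" for y
      using that by (auto simp: centraliser_def mat_trace_def)
    moreover have "0\<^sub>m n n \<in> centraliser n e" using e by (simp add: centraliser_def)
    ultimately show ?thesis by (metis (no_types, lifting))
  qed
qed

end

section \<open>Homogeneous components on the slice\<close>

lemma sym_homI:
  fixes X :: "'c \<Rightarrow> 't \<Rightarrow> 'a::field mat"
  assumes "finite K" and T: "\<And>\<kappa>. \<kappa> \<in> K \<Longrightarrow> finite (T \<kappa>) \<and> card (T \<kappa>) = m"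
    and X: "\<And>\<kappa> t. \<kappa> \<in> K \<Longrightarrow> t \<in> T \<kappa> \<Longrightarrow> X \<kappa> t \<in> centraliser n e"
  shows "(\<lambda>y\<in>centraliser n f. \<Sum>\<kappa>\<in>K. c \<kappa> * (\<Prod>t\<in>T \<kappa>. mat_trace (X \<kappa> t * y))) \<in> sym_hom n e f m"
proof -
  obtain g where g: "bij_betw g {0..<card K} K"
    using ex_bij_betw_nat_finite[OF assms(1)] by blast
  have "\<exists>h. bij_betw h {0..<m} (T \<kappa>)" if "\<kappa> \<in> K" for \<kappa>
    using ex_bij_betw_nat_finite T[OF that] by blast
  then obtain h where h: "\<And>\<kappa>. \<kappa> \<in> K \<Longrightarrow> bij_betw (h \<kappa>) {0..<m} (T \<kappa>)" by metis
  have gK: "g r \<in> K" if "r < card K" for r using g that by (auto simp: bij_betw_def)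
  have "(\<Sum>\<kappa>\<in>K. c \<kappa> * (\<Prod>t\<in>T \<kappa>. mat_trace (X \<kappa> t * y))) =
      (\<Sum>r<card K. c (g r) * (\<Prod>i<m. mat_trace (X (g r) (h (g r) i) * y)))" for y
  proof -
    have "(\<Sum>\<kappa>\<in>K. c \<kappa> * (\<Prod>t\<in>T \<kappa>. mat_trace (X \<kappa> t * y))) =
        (\<Sum>r = 0..<card K. c (g r) * (\<Prod>t\<in>T (g r). mat_trace (X (g r) t * y)))"
      by (rule sum.reindex_bij_betw[OF g, symmetric])
    also have "\<dots> = (\<Sum>r = 0..<card K. c (g r) * (\<Prod>i = 0..<m. mat_trace (X (g r) (h (g r) i) * y)))"
    proof (intro sum.cong refl arg_cong2[of _ _ _ _ "(*)"])
      fix r assume "r \<in> {0..<card K}"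
      then have "bij_betw (h (g r)) {0..<m} (T (g r))" using gK h by simp
      then show "(\<Prod>t\<in>T (g r). mat_trace (X (g r) t * y)) = (\<Prod>i = 0..<m. mat_trace (X (g r) (h (g r) i) * y))"
        by (rule prod.reindex_bij_betw[symmetric])
    qed
    finally show ?thesis by (simp only: atLeast0LessThan)
  qed
  moreover have "\<forall>r<card K. \<forall>i<m. X (g r) (h (g r) i) \<in> centraliser n e"
    using gK X bij_betwE[OF h] by simp
  ultimately show ?thesis
    unfolding sym_hom_def mem_Collect_eq
    by (intro exI[of _ "card K"] exI[of _ "\<lambda>r. c (g r)"] exI[of _ "\<lambda>r i. X (g r) (h (g r) i)"]) simp
qed

lemma smult_centraliser:
  fixes f :: "'a::field mat"
  assumes "f \<in> carrier_mat n n" "y \<in> centraliser n f"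
  shows "t \<cdot>\<^sub>m y \<in> centraliser n f"
  using assms by (auto simp: centraliser_def mult_smult_distrib[of _ n n] mult_smult_assoc_mat[of _ n n])

lemma sym_hom_smult:
  assumes e: "e \<in> carrier_mat n n" and f: "f \<in> carrier_mat n n"
    and p: "p \<in> sym_hom n e f m" and y: "y \<in> centraliser n f"
  shows "p (t \<cdot>\<^sub>m y) = t ^ m * p y"
proof -
  obtain N c X where X: "\<forall>r<N. \<forall>i<m. X r i \<in> centraliser n e"
    and p: "p = (\<lambda>y\<in>centraliser n f. \<Sum>r<(N::nat). c r * (\<Prod>i<m. mat_trace (X r i * y)))"
    using p unfolding sym_hom_def by blast
  have yc: "y \<in> carrier_mat n n" using y by (simp add: centraliser_def)
  have "mat_trace (X r i * (t \<cdot>\<^sub>m y)) = t * mat_trace (X r i * y)" if "r < N" "i < m" for r i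
  proof -
    have "X r i \<in> carrier_mat n n" using X that by (simp add: centraliser_def)
    then show ?thesis using yc
      by (simp add: mult_smult_distrib[of _ n n] mat_trace_def sum_distrib_left)
  qed
  then have "(\<Sum>r<N. c r * (\<Prod>i<m. mat_trace (X r i * (t \<cdot>\<^sub>m y)))) =
      (\<Sum>r<N. t ^ m * (c r * (\<Prod>i<m. mat_trace (X r i * y))))"
    by (intro sum.cong) (auto simp: prod.distrib)
  then show ?thesis
    using y smult_centraliser[OF f y] by (simp add: p sum_distrib_left)
qed

lemma sym_hom_outside: "p \<in> sym_hom n e f m \<Longrightarrow> y \<notin> centraliser n f \<Longrightarrow> p y = undefined"
  by (auto simp: sym_hom_def)

text \<open>The components are recovered from the polynomial \<open>t \<mapsto> p (t y)\<close>.\<close>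

lemma hom_decomposition_unique:
  fixes e f :: "'a::field_char_0 mat"
  assumes e: "e \<in> carrier_mat n n" and f: "f \<in> carrier_mat n n"
    and c: "hom_decomposition n e f p c" and c': "hom_decomposition n e f p c'"
  shows "c = c'"
proof -
  let ?S = "{m. c m \<noteq> sym_zero n f} \<union> {m. c' m \<noteq> sym_zero n f}"
  have fin: "finite ?S" using c c' by (simp add: hom_decomposition_def)
  then obtain N where N: "?S \<subseteq> {..<N}" using finite_nat_bounded by blast
  have expand: "p z = (\<Sum>m<N. b m z)"
    if b: "hom_decomposition n e f p b" "{m. b m \<noteq> sym_zero n f} \<subseteq> {..<N}" and z: "z \<in> centraliser n f" for b z
  proof -
    have "p z = (\<Sum>m | b m \<noteq> sym_zero n f. b m z)"
      using b(1) z by (auto simp: hom_decomposition_def)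
    also have "\<dots> = (\<Sum>m<N. b m z)"
      using b(2) z by (intro sum.mono_neutral_left) (auto simp: sym_zero_def)
    finally show ?thesis .
  qed
  have "c m y = c' m y" for m y
  proof (cases "y \<in> centraliser n f")
    case False
    then show ?thesis
      using c c' sym_hom_outside unfolding hom_decomposition_def by metis
  next
    case y: True
    have pol: "poly (\<Sum>m<N. monom (b m y) m) t = p (t \<cdot>\<^sub>m y)"
      if b: "hom_decomposition n e f p b" "{m. b m \<noteq> sym_zero n f} \<subseteq> {..<N}" for b t
    proof -
      have "p (t \<cdot>\<^sub>m y) = (\<Sum>m<N. b m (t \<cdot>\<^sub>m y))"
        by (rule expand[OF b smult_centraliser[OF f y]])
      also have "\<dots> = (\<Sum>m<N. t ^ m * b m y)"
        using b(1) y by (intro sum.cong refl sym_hom_smult[OF e f]) (auto simp: hom_decomposition_def)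
      finally show ?thesis by (simp add: poly_sum poly_monom mult.commute)
    qed
    \<comment> \<open>Both polynomials take the values \<open>p (t y)\<close> for all
      \<open>t\<close>, and a field of characteristic zero is infinite.\<close>
    have "poly (\<Sum>m<N. monom (c m y) m) = poly (\<Sum>m<N. monom (c' m y) m)"
      using pol[OF c] pol[OF c'] N by (intro ext) auto
    then have eq: "(\<Sum>m<N. monom (c m y) m) = (\<Sum>m<N. monom (c' m y) m)"
      by (simp add: poly_eq_poly_eq_iff)
    show ?thesis
    proof (cases "m < N")
      case True
      have "coeff (\<Sum>m<N. monom (b m) m) m = b m" for b :: "nat \<Rightarrow> 'a"
        using True by (simp add: coeff_sum)
      then show ?thesis using eq by metis
    next
      case False
      then have "c m = sym_zero n f" "c' m = sym_zero n f" using N by auto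
      then show ?thesis by simp
    qed
  qed
  then show ?thesis by blast
qed

section \<open>Homogeneous components of the coefficient on the slice\<close>

context jordan_slice
begin

lemma card_B_eq: "card B = n"
  using bij_betw_same_card[OF \<beta>] by simp

text \<open>Full expansion over the row set \<open>T\<close>, the shifts \<open>g\<close> produced
  by \<open>geom\<close> and a permutation \<open>p\<close> leaves products of \<open>m\<close>
  entries of \<open>y\<close>, each linear by \<open>co_eq_mat_trace\<close>.\<close>

lemma deg_part_sym_hom: "(\<lambda>y\<in>centraliser n f. deg_part m l (co y)) \<in> sym_hom n e f m"
proof -
  obtain X where X: "\<And>b c. b \<in> B \<Longrightarrow> c \<in> B \<Longrightarrow> X b c \<in> centraliser n e"
    "\<And>b c y. b \<in> B \<Longrightarrow> c \<in> B \<Longrightarrow> y \<in> centraliser n f \<Longrightarrow> co y b c = mat_trace (X b c * y)"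
    using co_eq_mat_trace by metis
  let ?G = "\<lambda>T. {g. g \<in> (\<Pi>\<^sub>E t\<in>T. {snd t..d (fst t)}) \<and> (\<Sum>t\<in>T. g t - snd t) = l - m}"
  let ?T = "{T. T \<subseteq> B \<and> card T = m}"
  let ?K = "SIGMA T:?T. ?G T \<times> {p. p permutes T}"
  let ?c = "\<lambda>(T, g, p). if m \<le> l then (- 1) ^ m * of_int (sign p) else (0 :: 'a)"
  let ?X = "\<lambda>(T, g, p) t. X t (fst (p t), g (p t))"
  have fT: "finite T" if "T \<in> ?T" for T using that finite_B finite_subset by blast
  have fG: "finite (?G T)" if "T \<in> ?T" for T
    by (rule finite_subset[OF _ finite_PiE[OF fT[OF that], of "\<lambda>t. {snd t..d (fst t)}"]]) auto
  have fK: "finite ?K"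
    using fT fG finite_B by (intro finite_SigmaI finite_cartesian_product) (auto simp: finite_permutations)
  have mem: "t \<in> B" "(fst (p t), g (p t)) \<in> B" if "(T, g, p) \<in> ?K" "t \<in> T" for T g p t
  proof -
    show "t \<in> B" using that by blast
    have "p t \<in> T" using that by (simp add: permutes_in_image)
    then have "p t \<in> B" "g (p t) \<le> d (fst (p t))" using that by (auto simp: PiE_iff)
    then show "(fst (p t), g (p t)) \<in> B" by (cases "p t") (simp add: mem_B)
  qed
  have "deg_part m l (co y) = (\<Sum>\<kappa>\<in>?K. ?c \<kappa> * (\<Prod>t\<in>fst \<kappa>. mat_trace (?X \<kappa> t * y)))"
    if y: "y \<in> centraliser n f" for y
  proof -
    have "deg_part m l (co y) = (\<Sum>T\<in>?T. \<Sum>g\<in>?G T. \<Sum>p | p permutes T.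
        ?c (T, g, p) * (\<Prod>t\<in>T. co y t (fst (p t), g (p t))))"
      unfolding deg_part_def
    proof (intro sum.cong refl)
      fix T assume "T \<in> ?T"
      then have T: "T \<subseteq> B" "card T = m" by auto
      show "coeff (sdet B (mixed (co y) T)) l = (\<Sum>g\<in>?G T. \<Sum>p | p permutes T.
          ?c (T, g, p) * (\<Prod>t\<in>T. co y t (fst (p t), g (p t))))"
        by (simp only: coeff_sdet_mixed[OF T(1)] T(2)) (simp add: sdet_def sum_distrib_left mult.assoc)
    qed
    also have "\<dots> = (\<Sum>T\<in>?T. \<Sum>(g, p)\<in>?G T \<times> {p. p permutes T}.
        ?c (T, g, p) * (\<Prod>t\<in>T. co y t (fst (p t), g (p t))))"
      by (intro sum.cong refl sum.cartesian_product)
    also have "\<dots> = (\<Sum>(T, g, p)\<in>?K. ?c (T, g, p) * (\<Prod>t\<in>T. co y t (fst (p t), g (p t))))"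
      using fT fG finite_B by (subst sum.Sigma) (auto simp: finite_permutations case_prod_unfold)
    also have "\<dots> = (\<Sum>\<kappa>\<in>?K. ?c \<kappa> * (\<Prod>t\<in>fst \<kappa>. mat_trace (?X \<kappa> t * y)))"
    proof (intro sum.cong refl)
      fix \<kappa> assume \<kappa>: "\<kappa> \<in> ?K"
      obtain T g p where eq: "\<kappa> = (T, g, p)" using prod_cases3 by blast
      have "(\<Prod>t\<in>T. co y t (fst (p t), g (p t))) = (\<Prod>t\<in>T. mat_trace (X t (fst (p t), g (p t)) * y))"
        using mem[OF \<kappa>[unfolded eq]] by (intro prod.cong refl X(2)[OF _ _ y]) auto
      then show "(case \<kappa> of (T, g, p) \<Rightarrow> ?c (T, g, p) * (\<Prod>t\<in>T. co y t (fst (p t), g (p t)))) =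
          ?c \<kappa> * (\<Prod>t\<in>fst \<kappa>. mat_trace (?X \<kappa> t * y))"
        by (simp add: eq)
    qed
    finally show ?thesis .
  qed
  then have "(\<lambda>y\<in>centraliser n f. deg_part m l (co y)) =
      (\<lambda>y\<in>centraliser n f. \<Sum>\<kappa>\<in>?K. ?c \<kappa> * (\<Prod>t\<in>fst \<kappa>. mat_trace (?X \<kappa> t * y)))"
    by (rule restrict_ext)
  also have "\<dots> \<in> sym_hom n e f m"
  proof (rule sym_homI[OF fK])
    fix \<kappa> assume "\<kappa> \<in> ?K"
    then have "fst \<kappa> \<in> ?T" by auto
    then show "finite (fst \<kappa>) \<and> card (fst \<kappa>) = m" using fT[of "fst \<kappa>"] by blast
  next
    fix \<kappa> t assume \<kappa>: "\<kappa> \<in> ?K" "t \<in> fst \<kappa>"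
    obtain T g p where eq: "\<kappa> = (T, g, p)" using prod_cases3 by blast
    show "?X \<kappa> t \<in> centraliser n e"
      unfolding eq prod.case using mem[of T g p t] \<kappa> unfolding eq fst_conv by (intro X(1)) blast+
  qed
  finally show ?thesis .
qed

lemma char_coeff_slice:
  assumes y: "y \<in> carrier_mat n n" and "l \<le> n"
  shows "char_coeff n l (e + y) = (\<Sum>m\<le>n. deg_part m l (co y))"
proof -
  have "char_coeff n l (e + y) = coeff (sdet B (\<lambda>b c. - [:0, 1:] * [:shift b c + co y b c:] + (if b = c then 1 else 0))) l"
    using e y by (intro char_coeff_co assms(2)) (auto simp: co_add co_e)
  then show ?thesis using sum_mixed[OF finite_B, of l "co y"] by (simp only: card_B_eq)
qed

lemma deg_part_eq_0:
  assumes "n < m"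
  shows "deg_part m l Y = 0"
proof -
  have "card T \<noteq> m" if "T \<subseteq> B" for T
    using assms card_mono[OF finite_B that] by (simp add: card_B_eq)
  then have "{T. T \<subseteq> B \<and> card T = m} = {}" by blast
  then show ?thesis unfolding deg_part_def by (simp only: sum.empty)
qed

lemma hom_component_slice:
  assumes "l \<le> n"
  shows "hom_component n e f (slice_restriction n e f (char_coeff n l)) =
    (\<lambda>m. \<lambda>y\<in>centraliser n f. deg_part m l (co y))" (is "_ = ?c")
proof -
  have sub: "{m. ?c m \<noteq> sym_zero n f} \<subseteq> {..n}"
  proof
    fix m assume m: "m \<in> {m. ?c m \<noteq> sym_zero n f}"
    have "?c m = sym_zero n f" if "n < m"
      unfolding sym_zero_def by (intro restrict_ext deg_part_eq_0[OF that])
    with m show "m \<in> {..n}" by (auto simp: not_le[symmetric])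
  qed
  have "char_coeff n l (e + y) = (\<Sum>m | ?c m \<noteq> sym_zero n f. ?c m y)" if y: "y \<in> centraliser n f" for y
  proof -
    have "char_coeff n l (e + y) = (\<Sum>m\<le>n. ?c m y)"
      using y assms by (simp add: char_coeff_slice centraliser_def)
    also have "\<dots> = (\<Sum>m | ?c m \<noteq> sym_zero n f. ?c m y)"
      using sub y by (intro sum.mono_neutral_right) (auto simp: sym_zero_def)
    finally show ?thesis .
  qed
  then have "slice_restriction n e f (char_coeff n l) =
      (\<lambda>y\<in>centraliser n f. \<Sum>m | ?c m \<noteq> sym_zero n f. ?c m y)"
    unfolding slice_restriction_def by (rule restrict_ext)
  then have "hom_decomposition n e f (slice_restriction n e f (char_coeff n l)) ?c"
    unfolding hom_decomposition_def
    using deg_part_sym_hom finite_subset[OF sub] by blast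
  then show ?thesis
    unfolding hom_component_def using hom_decomposition_unique[OF e f] by (intro the_equality) auto
qed

text \<open>A factor has weight \<open>2 s i - d (p i) + d i\<close>. The block sizes cancel over a
  permutation, and characteristic zero lets the remaining equation be read in the naturals.\<close>

lemma Xi_indices_eq:
  assumes "m \<le> l"
  shows "Xi_indices n e h k d w m (2 * (of_nat l - of_nat m)) =
    (SIGMA I:{I. I \<subseteq> {1..k} \<and> card I = m}. SIGMA p:{p. p permutes I}.
      {s. s \<in> (\<Pi>\<^sub>E i\<in>I. xi_range d i (p i)) \<and> sum s I = l - m})"
proof -
  have "Xi_weight n e h k d w I p s = 2 * (of_nat l - of_nat m) \<longleftrightarrow> sum s I = l - m"
    if I: "I \<subseteq> {1..k}" and p: "p permutes I" and s: "s \<in> (\<Pi>\<^sub>E i\<in>I. xi_range d i (p i))" for I p s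
  proof -
    have "Xi_weight n e h k d w I p s = (\<Sum>i\<in>I. 2 * of_nat (s i) - of_nat (d (p i)) + of_nat (d i))"
      unfolding Xi_weight_def
    proof (intro sum.cong refl ad_eigenvalue_xi)
      fix i assume i: "i \<in> I"
      then show "i \<in> {1..k}" "p i \<in> {1..k}" using I p by (auto simp: permutes_in_image subset_iff)
      show "s i \<in> xi_range d i (p i)" using s i by (rule PiE_mem)
    qed
    also have "\<dots> = 2 * of_nat (sum s I) - (\<Sum>i\<in>I. of_nat (d (p i))) + (\<Sum>i\<in>I. of_nat (d i))"
      by (simp add: sum.distrib sum_subtractf sum_distrib_left)
    also have "(\<Sum>i\<in>I. of_nat (d (p i))) = (\<Sum>i\<in>I. of_nat (d i) :: 'a)"
      using sum.permute[OF p, of "\<lambda>i. of_nat (d i) :: 'a"] by (simp add: comp_def)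
    finally have 1: "Xi_weight n e h k d w I p s = 2 * of_nat (sum s I)" by simp
    have 2: "of_nat l - of_nat m = (of_nat (l - m) :: 'a)" using assms by simp
    show ?thesis unfolding 1 2 by (simp only: mult_cancel_left of_nat_eq_iff) simp
  qed
  then show ?thesis unfolding Xi_indices_def by auto
qed

lemma finite_index_fibres:
  assumes "I \<subseteq> {1..k}"
  shows "finite {p. p permutes I}" "finite {s. s \<in> (\<Pi>\<^sub>E i\<in>I. xi_range d i (p i)) \<and> sum s I = r}"
proof -
  have fI: "finite I" using assms finite_subset by blast
  then show "finite {p. p permutes I}" by (rule finite_permutations)
  show "finite {s. s \<in> (\<Pi>\<^sub>E i\<in>I. xi_range d i (p i)) \<and> sum s I = r}"
    by (rule finite_subset[OF _ finite_PiE[OF fI, of "\<lambda>i. xi_range d i (p i)"]]) (auto simp: xi_range_def)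
qed

lemma deg_part_Xi:
  assumes l: "m \<le> l" "L (m - 1) < l" and y: "y \<in> centraliser n f"
  shows "deg_part m l (co y) = (- 1) ^ m * (\<Sum>(I, p, s)\<in>Xi_indices n e h k d w m (2 * (of_nat l - of_nat m)).
    of_int (sign p) * (\<Prod>i\<in>I. diag_sum (co y) i (p i) (s i)))"
proof -
  let ?I = "{I. I \<subseteq> {1..k} \<and> card I = m}"
  let ?S = "\<lambda>I p. {s. s \<in> (\<Pi>\<^sub>E i\<in>I. xi_range d i (p i)) \<and> sum s I = l - m}"
  let ?t = "\<lambda>I p s. of_int (sign p) * (\<Prod>i\<in>I. diag_sum (co y) i (p i) (s i))"
  have "(\<Sum>I\<in>?I. \<Sum>p | p permutes I. \<Sum>s\<in>?S I p. ?t I p s) =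
      (\<Sum>I\<in>?I. \<Sum>(p, s)\<in>(SIGMA p:{p. p permutes I}. ?S I p). ?t I p s)"
    using finite_index_fibres by (intro sum.cong refl sum.Sigma) blast+
  also have "\<dots> = (\<Sum>(I, p, s)\<in>(SIGMA I:?I. SIGMA p:{p. p permutes I}. ?S I p). ?t I p s)"
    using finite_index_fibres by (intro sum.Sigma ballI finite_SigmaI) auto
  also note Xi_indices_eq[OF l(1), symmetric]
  finally have "(- 1) ^ m * (\<Sum>I\<in>?I. \<Sum>p | p permutes I. \<Sum>s\<in>?S I p. ?t I p s) =
      (- 1) ^ m * (\<Sum>(I, p, s)\<in>Xi_indices n e h k d w m (2 * (of_nat l - of_nat m)). ?t I p s)"
    by (rule arg_cong)
  moreover have "deg_part m l (co y) =
      (- 1) ^ m * (\<Sum>I\<in>?I. \<Sum>p | p permutes I. \<Sum>s\<in>?S I p. ?t I p s)"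
    by (rule deg_part_eq_diag_sums[OF l]) (rule co_centraliser_f_range[OF y])
  ultimately show ?thesis by (rule trans[rotated])
qed

lemma Xi_eq_diag_sums:
  assumes "(I, p, s) \<in> Xi_indices n e h k d w m a" and y: "y \<in> centraliser n f"
  shows "Xi n e f k d w I p s y = (\<Prod>i\<in>I. diag_sum (co y) i (p i) (s i))"
proof -
  have I: "I \<subseteq> {1..k}" and p: "p permutes I" and s: "s \<in> (\<Pi>\<^sub>E i\<in>I. xi_range d i (p i))"
    using assms(1) by (auto simp: Xi_indices_def)
  have "mat_trace (xi n e k d w i (p i) (s i) * y) = diag_sum (co y) i (p i) (s i)" if i: "i \<in> I" for i
  proof (rule mat_trace_xi)
    show "i \<in> {1..k}" "p i \<in> {1..k}" using I p i by (auto simp: permutes_in_image subset_iff)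
    show "s i \<in> xi_range d i (p i)" using s i by (rule PiE_mem)
    show "y \<in> carrier_mat n n" using y by (simp add: centraliser_def)
  qed
  then show ?thesis using y by (simp add: Xi_def)
qed

text \<open>
  The witness is block diagonal: the full antidiagonal power of \<open>f\<close> on the first \<open>m - 1\<close> Jordan
  blocks and the power that uses up the remaining \<open>l - L (m - 1)\<close> basis vectors on the \<open>m\<close>-th one,
  so that a single triple \<open>(I, \<sigma>, s)\<close> contributes.
\<close>

lemma deg_part_nonzero:
  assumes m: "1 \<le> m" "m \<le> k" and l: "L (m - 1) < l" "l \<le> L m"
  shows "\<exists>y\<in>centraliser n f. deg_part m l (co y) \<noteq> 0"
proof -
  \<comment> \<open>A jump by \<open>r i\<close> accounts for \<open>r i + 1\<close> basis vectors,
    hence the final \<open>- 1\<close>; the total over the \<open>m\<close> blocks is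
    \<open>l\<close>, so the jumps add up to \<open>l - m\<close>.\<close>
  define r where "r = (\<lambda>i. if i < m then d i else l - L (m - 1) - 1)"
  have Lm: "L m = L (m - 1) + d m + 1" using m by (cases m) (simp_all add: L_def)
  have r: "r i \<le> d i" if "i \<le> m" for i
    using that l Lm by (auto simp: r_def dest: le_neq_implies_less)
  have ml: "m \<le> l" using le_L[of "m - 1"] l m by linarith
  have sum_r: "sum r {1..m} = l - m"
  proof -
    have "sum r {1..m} = sum r {1..m - 1} + r m" using m by (cases m) simp_all
    also have "sum r {1..m - 1} = sum d {1..m - 1}" by (intro sum.cong) (auto simp: r_def)
    finally have "sum r {1..m} = sum d {1..m - 1} + (l - L (m - 1) - 1)" by (simp add: r_def)
    moreover have "L (m - 1) = sum d {1..m - 1} + (m - 1)" unfolding L_def sum.distrib by simp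
    ultimately show ?thesis using l m by linarith
  qed
  \<comment> \<open>On each chosen diagonal the bottom entry is 1, and the other entries are the
    ones that commuting with \<open>f\<close> then forces.\<close>
  define Y where "Y = (\<lambda>b c. if fst b = fst c \<and> fst b \<le> m \<and> snd c = snd b + r (fst b)
    then of_rat (diag_ratio (fst b) (fst b) (r (fst b)) (snd b)) else (0 :: 'a))"
  let ?y = "of_co Y"
  have y: "?y \<in> centraliser n f"
    unfolding centraliser_f_iff
  proof (intro conjI of_co_carrier allI impI)
    fix i a j b assume ij: "(i, a) \<in> B" "(j, b) \<in> B"
    have "(if a < d i then of_nat (f_coeff i (a + 1)) * Y (i, a + 1) (j, b) else 0) =
        (if b > 0 then Y (i, a) (j, b - 1) * of_nat (f_coeff j b) else 0)"
    proof (cases "i = j \<and> i \<le> m \<and> b = a + r i + 1")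
      case True
      then have "a < d i" using ij by (auto simp: mem_B)
      then show ?thesis using True diag_ratio_Suc[of a i i "r i"] by (simp add: Y_def)
    next
      case False
      then show ?thesis by (auto simp: Y_def)
    qed
    moreover have "co ?y (i, a + 1) (j, b) = Y (i, a + 1) (j, b)" if "a < d i"
      using ij that by (intro co_of_co) (auto simp: mem_B)
    moreover have "co ?y (i, a) (j, b - 1) = Y (i, a) (j, b - 1)"
      using ij by (intro co_of_co) (auto simp: mem_B)
    ultimately show "(if a < d i then of_nat (f_coeff i (a + 1)) * co ?y (i, a + 1) (j, b) else 0) =
        (if b > 0 then co ?y (i, a) (j, b - 1) * of_nat (f_coeff j b) else 0)"
      by (simp cong: if_cong)
  qed
  have ds: "diag_sum (co ?y) i j s = (if i = j \<and> i \<le> m \<and> s = r i then of_rat (diag_total i i (r i)) else 0)"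
    if ij: "i \<in> {1..k}" "j \<in> {1..k}" and s: "s \<le> d j" for i j s
  proof -
    have "diag_sum (co ?y) i j s = of_rat (diag_total i j s) * Y (i, 0) (j, s)"
      using ij s diag_sum_centraliser_f[OF y ij] by (simp add: co_of_co mem_B)
    then show ?thesis by (auto simp: Y_def diag_ratio_def)
  qed
  let ?K = "Xi_indices n e h k d w m (2 * (of_nat l - of_nat m))"
  let ?x = "({1..m}, id :: nat \<Rightarrow> nat, \<lambda>i\<in>{1..m}. r i)"
  let ?t = "\<lambda>(I, p, s). of_int (sign p) * (\<Prod>i\<in>I. diag_sum (co ?y) i (p i) (s i))"
  have K: "?K = (SIGMA I:{I. I \<subseteq> {1..k} \<and> card I = m}. SIGMA p:{p. p permutes I}.
      {s. s \<in> (\<Pi>\<^sub>E i\<in>I. xi_range d i (p i)) \<and> sum s I = l - m})" by (rule Xi_indices_eq[OF ml])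
  have finK: "finite ?K" unfolding K by (intro finite_SigmaI) (auto simp: finite_index_fibres)
  have xK: "?x \<in> ?K"
    unfolding K using m r sum_r by (auto simp: xi_range_def permutes_id)
  \<comment> \<open>A nonzero factor requires \<open>p i = i\<close>, \<open>i \<le> m\<close> and
    \<open>s i = r i\<close>; if this holds on all of \<open>I\<close>, then
    \<open>card I = m\<close> leaves only \<open>?x\<close>.\<close>
  have other: "?t \<kappa> = 0" if \<kappa>: "\<kappa> \<in> ?K - {?x}" for \<kappa>
  proof -
    obtain I p s where eq: "\<kappa> = (I, p, s)" using prod_cases3 by blast
    have I: "I \<subseteq> {1..k}" "card I = m" and p: "p permutes I" and s: "s \<in> (\<Pi>\<^sub>E i\<in>I. xi_range d i (p i))"
      using \<kappa> unfolding K eq by auto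
    have fI: "finite I" using I finite_subset by blast
    have "\<exists>i\<in>I. \<not> (i = p i \<and> i \<le> m \<and> s i = r i)"
    proof (rule ccontr)
      assume "\<not> ?thesis"
      then have all: "\<And>i. i \<in> I \<Longrightarrow> i = p i \<and> i \<le> m \<and> s i = r i" by blast
      then have "I \<subseteq> {1..m}" using I by auto
      then have "I = {1..m}" using I by (intro card_subset_eq) auto
      moreover have "p = id" using all p by (metis eq_id_iff permutes_not_in)
      moreover have "s = (\<lambda>i\<in>I. r i)" using all s by (intro extensionalityI[of _ I]) (auto simp: PiE_def)
      ultimately show False using \<kappa> eq by simp
    qed
    then obtain i where i: "i \<in> I" "\<not> (i = p i \<and> i \<le> m \<and> s i = r i)" by blast
    have "i \<in> {1..k}" "p i \<in> {1..k}" using I p i by (auto simp: permutes_in_image subset_iff)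
    moreover have "s i \<le> d (p i)" using PiE_mem[OF s i(1)] by (simp add: xi_range_def)
    ultimately have "diag_sum (co ?y) i (p i) (s i) =
        (if i = p i \<and> i \<le> m \<and> s i = r i then of_rat (diag_total i (p i) (r i)) else 0)"
      using ds by auto
    then have "diag_sum (co ?y) i (p i) (s i) = 0" using i(2) by (simp only: if_False)
    then have "(\<Prod>i\<in>I. diag_sum (co ?y) i (p i) (s i)) = 0" using i fI by (intro prod_zero) auto
    then show ?thesis by (simp add: eq)
  qed
  have "(\<Sum>\<kappa>\<in>?K. ?t \<kappa>) = ?t ?x"
    using other sum.remove[OF finK xK, of ?t] by (simp add: sum.neutral)
  also have "?t ?x = (\<Prod>i = 1..m. of_rat (diag_total i i (r i)))"
  proof -
    have "(\<Prod>i = 1..m. diag_sum (co ?y) i (id i) ((\<lambda>i\<in>{1..m}. r i) i)) = (\<Prod>i = 1..m. of_rat (diag_total i i (r i)))"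
      using m r by (intro prod.cong refl) (simp add: ds)
    then show ?thesis by (simp add: sign_id)
  qed
  also have "\<dots> \<noteq> 0"
  proof -
    have "diag_total i i (r i) \<noteq> 0" if "i \<in> {1..m}" for i
      using diag_total_pos[OF r, of i i] that by simp
    then show ?thesis by (simp add: prod_zero_iff)
  qed
  finally have "(\<Sum>\<kappa>\<in>?K. ?t \<kappa>) \<noteq> 0" .
  then have "deg_part m l (co ?y) \<noteq> 0" unfolding deg_part_Xi[OF ml l(1) y] by simp
  with y show ?thesis by blast
qed

lemma initial_form_char_coeff:
  assumes l: "1 \<le> l" "l \<le> n" and m: "m = initial_degree n e f (char_coeff n l)"
  shows "initial_form n e f (char_coeff n l) = (\<lambda>y\<in>centraliser n f. (- 1) ^ m *
    (\<Sum>(I, \<sigma>, s)\<in>Xi_indices n e h k d w m (2 * (of_nat l - of_nat m)).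
      of_int (sign \<sigma>) * Xi n e f k d w I \<sigma> s y))"
proof -
  define m0 where "m0 = (LEAST m. l \<le> L m)"
  have lk: "l \<le> L k" using l card_B card_B_eq by simp
  then have m0: "l \<le> L m0" "m0 \<le> k" unfolding m0_def by (auto intro: LeastI Least_le)
  have "m0 \<noteq> 0" using m0(1) l by (auto simp: L_def intro: gr0I)
  then have lt: "L (m0 - 1) < l"
    using not_less_Least[of "m0 - 1" "\<lambda>m. l \<le> L m"] by (simp add: m0_def)
  let ?c = "\<lambda>m. \<lambda>y\<in>centraliser n f. deg_part m l (co y)"
  obtain y where "y \<in> centraliser n f" "deg_part m0 l (co y) \<noteq> 0"
    using deg_part_nonzero[of m0] m0 lt \<open>m0 \<noteq> 0\<close> by auto
  then have "?c m0 \<noteq> sym_zero n f" unfolding sym_zero_def by (metis restrict_apply')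
  \<comment> \<open>The formula holds in every degree up to \<open>m0\<close>, because
    \<open>L (m - 1)\<close> is monotone in \<open>m\<close>; a nonzero component at
    \<open>m0\<close> thus suffices.\<close>
  then have "m \<le> m0" unfolding m initial_degree_def hom_component_slice[OF l(2)] by (rule Least_le)
  then have lm: "L (m - 1) < l" using lt L_mono[of "m - 1" "m0 - 1"] by linarith
  have ml: "m \<le> l" using lt le_L[of "m0 - 1"] \<open>m \<le> m0\<close> by linarith
  have "deg_part m l (co y) = (- 1) ^ m *
      (\<Sum>(I, \<sigma>, s)\<in>Xi_indices n e h k d w m (2 * (of_nat l - of_nat m)). of_int (sign \<sigma>) * Xi n e f k d w I \<sigma> s y)"
    if y: "y \<in> centraliser n f" for y
    unfolding deg_part_Xi[OF ml lm y] using Xi_eq_diag_sums[OF _ y]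
    by (intro arg_cong2[of _ _ _ _ "(*)"] refl sum.cong) auto
  then have "?c m = (\<lambda>y\<in>centraliser n f. (- 1) ^ m *
      (\<Sum>(I, \<sigma>, s)\<in>Xi_indices n e h k d w m (2 * (of_nat l - of_nat m)). of_int (sign \<sigma>) * Xi n e f k d w I \<sigma> s y))"
    by (rule restrict_ext)
  then show ?thesis
    unfolding initial_form_def m[symmetric] hom_component_slice[OF l(2)] .
qed

end

section \<open>Coordinates from Jordan generators, and the theorem\<close>

lemma basis_matrix:
  fixes v :: "'b \<Rightarrow> 'a::field vec"
  assumes fin: "finite B" and inj: "inj_on v B"
    and basis: "vectorspace.basis class_ring (module_vec TYPE('a) n) (v ` B)"
  obtains \<beta> P Q where "mat_coords n B \<beta> P Q" "\<And>b. b \<in> B \<Longrightarrow> mat_coords.bas n \<beta> P b = v b"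
proof -
  have fin': "finite (v ` B)" using fin by simp
  obtain \<beta> :: "nat \<Rightarrow> 'b" where \<beta>': "bij_betw \<beta> {0..<card B} B"
    using ex_bij_betw_nat_finite[OF fin] by blast
  interpret vec_space "TYPE('a)" n .
  have b: "lin_indpt (v ` B)" "v ` B \<subseteq> carrier_vec n" using basis by (auto simp: basis_def)
  have "card B = n"
    using dim_basis[OF fin' basis] card_image[OF inj] by (simp add: dim_is_n)
  then have \<beta>: "bij_betw \<beta> {0..<n} B" using \<beta>' by simp
  define P where "P = mat_of_cols n (map (\<lambda>i. v (\<beta> i)) [0..<n])"
  have P: "P \<in> carrier_mat n n" 
    unfolding P_def using mat_of_cols_carrier(1)[of n "map (\<lambda>i. v (\<beta> i)) [0..<n]"] by simp
  have vc: "v (\<beta> i) \<in> carrier_vec n" if "i < n" for i using b(2) \<beta> that by (auto simp: bij_betw_def)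
  have cols: "cols P = map (\<lambda>i. v (\<beta> i)) [0..<n]"
    unfolding P_def using vc by (intro cols_mat_of_cols) auto
  have "inj_on (\<lambda>i. v (\<beta> i)) {0..<n}"
    using comp_inj_on[of \<beta> "{0..<n}" v] \<beta> inj by (auto simp: bij_betw_def comp_def)
  then have "distinct (cols P)" unfolding cols by (simp add: distinct_map)
  moreover have "set (cols P) = v ` B" unfolding cols using \<beta> by (auto simp: bij_betw_def)
  ultimately have "rank P = n" using lin_indpt_full_rank[OF P] b by simp
  then have det: "det P \<noteq> 0" using det_rank_iff[OF P] by simp
  define Q where "Q = (1 / det P) \<cdot>\<^sub>m adj_mat P"
  have adj: "adj_mat P \<in> carrier_mat n n" "P * adj_mat P = det P \<cdot>\<^sub>m 1\<^sub>m n" "adj_mat P * P = det P \<cdot>\<^sub>m 1\<^sub>m n"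
    using adj_mat[OF P] by auto
  have c: "mat_coords n B \<beta> P Q"
  proof
    show "P * Q = 1\<^sub>m n" "Q * P = 1\<^sub>m n"
      unfolding Q_def using adj P det
      by (auto simp: mult_smult_distrib[of _ n n] mult_smult_assoc_mat[of _ n n] intro!: eq_matI)
  qed (use P adj \<beta> in \<open>auto simp: Q_def\<close>)
  have "mat_coords.bas n \<beta> P b = v b" if "b \<in> B" for b
  proof -
    have "inv_into {0..<n} \<beta> b < n" "\<beta> (inv_into {0..<n} \<beta> b) = b"
      using mat_coords.idx[OF c that] mat_coords.\<beta>_idx[OF c that] by auto
    then show ?thesis
      unfolding mat_coords.bas_def[OF c]
      using cols_nth[of "inv_into {0..<n} \<beta> b" P] carrier_matD[OF P] by (simp add: cols)
  qed
  with c show ?thesis by (rule that)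
qed

theorem theorem15:
  fixes n k l m :: nat
    and e h f :: "'a::{alg_closed_field, field_char_0} mat"
    and d :: "nat \<Rightarrow> nat"
    and w :: "nat \<Rightarrow> 'a vec"
  assumes "e \<in> carrier_mat n n"
    and "\<exists>N. e ^\<^sub>m N = 0\<^sub>m n n"
    and "jordan_generators n e k d w"
    and "sl2_triple n e h f"
    and "\<forall>i\<in>{1..k}. \<forall>s\<in>{0..d i}.
           h *\<^sub>v ((e ^\<^sub>m s) *\<^sub>v w i) = (2 * of_nat s - of_nat (d i)) \<cdot>\<^sub>v ((e ^\<^sub>m s) *\<^sub>v w i)"
    and "1 \<le> l" and "l \<le> n"
    and "m = initial_degree n e f (char_coeff n l)"
  shows "\<exists>c. c \<noteq> 0 \<and>
           initial_form n e f (char_coeff n l) =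
             (\<lambda>y\<in>centraliser n f. c *
               (\<Sum>(I, \<sigma>, s)\<in>Xi_indices n e h k d w m (2 * (of_nat l - of_nat m)).
                  of_int (sign \<sigma>) * Xi n e f k d w I \<sigma> s y))"
proof -
  let ?v = "\<lambda>(i, s). (e ^\<^sub>m s) *\<^sub>v w i"
  have anti: "\<forall>i\<in>{1..k}. \<forall>j\<in>{1..k}. i \<le> j \<longrightarrow> d j + 1 \<le> d i + 1"
    and w: "\<forall>i\<in>{1..k}. w i \<in> carrier_vec n"
    and inj: "inj_on ?v (SIGMA i:{1..k}. {0..d i})"
    and basis: "vectorspace.basis class_ring (module_vec TYPE('a) n) (?v ` (SIGMA i:{1..k}. {0..d i}))"
    and top: "\<forall>i\<in>{1..k}. (e ^\<^sub>m (d i + 1)) *\<^sub>v w i = 0\<^sub>v n"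
    using assms(3) unfolding jordan_generators_def by blast+
  interpret T: jordan_type k d
  proof
    fix i j assume "1 \<le> i" "i \<le> j" "j \<le> k"
    then show "d j \<le> d i" using anti by force
  qed
  obtain \<beta> P Q where c: "mat_coords n T.B \<beta> P Q"
    and bas: "\<And>b. b \<in> T.B \<Longrightarrow> mat_coords.bas n \<beta> P b = ?v b"
    using basis_matrix[OF T.finite_B[unfolded T.B_def] inj basis] unfolding T.B_def by blast
  interpret mat_coords n T.B \<beta> P Q by (rule c)
  interpret jordan_slice k d n \<beta> P Q e h f w
  proof
    fix i s assume b: "(i, s) \<in> T.B"
    show e: "bas (i, s) = (e ^\<^sub>m s) *\<^sub>v w i" using bas[OF b] by simp
    show "h *\<^sub>v bas (i, s) = (2 * of_nat s - of_nat (d i)) \<cdot>\<^sub>v bas (i, s)"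
      unfolding e using b assms(5) by (simp add: T.B_def)
  qed (use w top assms(4) in blast)+
  \<comment> \<open>The constant \<open>(- 1) ^ m\<close> collects the signs of the \<open>m\<close>
    rows taken from \<open>- u y\<close>.\<close>
  show ?thesis
    using initial_form_char_coeff[OF assms(6,7,8)] by (intro exI[of _ "(- 1) ^ m"]) simp
qed

end
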